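(* Let $n\ge 1$ and let $B$ be a finite multiset of elements of $\mathfrak{S}_n$. The following are equivalent: (a) $B$ is $D$-symmetric; (b) $B$ is $D$-commutative with all inverse $J$-classes, i.e. $BR_J^{-1}\equiv R_J^{-1}B$ for all $J\subseteq[n-1]$; (c) $BR_J^{-1}\equiv BR_K^{-1}$ for all $J,K\subseteq[n-1]$ with $J\sim K$; (d) $R_J^{-1}B\equiv R_K^{-1}B$ for all $J,K\subseteq[n-1]$ with $J\sim K$; (e) $B$ is symmetric.
   Context: $[n]=\{1,\dots,n\}$ and $\mathfrak{S}_n$ is the symmetric group on $[n]$; the product is composition, $(\pi\tau)_i=\pi_{\tau_i}$. For $\pi\in\mathfrak{S}_n$, $\mathrm{Des}(\pi)=\{i\in[n-1]:\pi_i>\pi_{i+1}\}$. For $J\subseteq[n-1]$, the inverse $J$-class is $R_J^{-1}=\{\pi^{-1}:\pi\in\mathfrak{S}_n,\ \mathrm{Des}(\pi)\subseteq J\}$. Multisets: for multisets $A,B$ of elements of $\mathfrak{S}_n$, $AB$ is the multiset of all products $\pi\tau$ with $\pi\in A,\tau\in B$ (with multiplicity). $A\equiv B$ means there is a bijection between $A$ and $B$ preserving descent sets, i.e. for each $D\subseteq[n-1]$ the numbers of elements (with multiplicity) with descent set $D$ in $A$ and in $B$ agree. Bijections between multisets treat repeated elements as distinct copies. Compositions: for $J=\{j_1<\dots<j_s\}\subseteq[n-1]$, $\mathrm{co}(J)=(j_1,j_2-j_1,\dots,j_s-j_{s-1},n-j_s)$, a composition of $n$. Write $J\sim K$ if $\mathrm{co}(J)$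 is a rearrangement of $\mathrm{co}(K)$. Symmetric: for a composition $\alpha=(\alpha_1,\dots,\alpha_p)$ of $n$, $M_\alpha=\sum_{i_1<\cdots<i_p}x_{i_1}^{\alpha_1}\cdots x_{i_p}^{\alpha_p}$ (variables $x_1,x_2,\dots$), and $F_\alpha=\sum_{\beta\le\alpha}M_\beta$ over all refinements $\beta$ of $\alpha$ (including $\alpha$). $F_{J,n}:=F_{\mathrm{co}(J)}$. $Q(B)=\sum_{\pi\in B}F_{\mathrm{Des}(\pi),n}$ (with multiplicity). $B$ is symmetric if $Q(B)$ is a symmetric function, i.e. invariant under all permutations of the variables. $D$-symmetric: an ordered set partition $\mathcal{U}=(U_1,\dots,U_s)$ of $[n]$ is a sequence of nonempty pairwise disjoint sets (blocks) with union $[n]$. $\delta_{\mathcal{U}}\in\mathfrak{S}_n$ is the permutation, increasing on each block $U_i$, that maps $U_1$ onto $\{1,\dots,|U_1|\}$, $U_2$ onto the next $|U_2|$ integers, and so on. Also $\mathcal{U}^*=U_1^*\cup U_2^*\cup\cdots\subseteq[n-1]$, where $S^*=\{i\in S:i+1\in S\}$. $B$ is $D$-symmetric if for every ordered set partition $\mathcal{U}$ of $[n]$ there is a bijection $\Psi_{\mathcal{U}}:B\to B$ such that for all $u\in\mathcal{U}^*$ and $\pi\in B$: $u\in\mathrm{Des}(\pi)\iff\delta_{\mathcal{U}}(u)\in\mathrm{Des}(\Psi_{\mathcal{U}}(\pi))$. *)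

theory Defs
  imports
    "HOL-Library.Multiset"
    "HOL-Library.Poly_Mapping"
    "HOL-Library.Disjoint_Sets"
    "HOL-Combinatorics.Permutations"
begin

text \<open>
  An element of the symmetric group on \<open>{1..n}\<close> is a function \<open>\<pi> :: nat \<Rightarrow> nat\<close> with
  \<open>\<pi> permutes {1..n}\<close>; the group product is \<open>\<circ>\<close>.
\<close>

definition Des :: "nat \<Rightarrow> (nat \<Rightarrow> nat) \<Rightarrow> nat set" where
  "Des n \<pi> = {i \<in> {1..n - 1}. \<pi> i > \<pi> (i + 1)}"

definition inverse_J_class :: "nat \<Rightarrow> nat set \<Rightarrow> (nat \<Rightarrow> nat) multiset" where
  "inverse_J_class n J = mset_set {inv \<pi> | \<pi>. \<pi> permutes {1..n} \<and> Des n \<pi> \<subseteq> J}"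

lemma finite_inverse_J_class:
  "finite {inv \<pi> | \<pi>. \<pi> permutes {1..n} \<and> Des n \<pi> \<subseteq> J}"
  using finite_permutations[of "{1..n}"] by simp

definition mset_mult :: "(nat \<Rightarrow> nat) multiset \<Rightarrow> (nat \<Rightarrow> nat) multiset \<Rightarrow> (nat \<Rightarrow> nat) multiset" where
  "mset_mult A B = (\<Sum>\<pi>\<in>#A. {#\<pi> \<circ> \<tau>. \<tau> \<in># B#})"

text \<open>
  Bijections between multisets treat repeated elements as distinct: they are bijections between
  sets of labelled copies, the copies of \<open>x\<close> being \<open>(x, k)\<close> with \<open>k < count A x\<close>.
\<close>

definition copies :: "'a multiset \<Rightarrow> ('a \<times> nat) set" where
  "copies A = {(x, k). k < count A x}"

definition Des_equiv :: "nat \<Rightarrow> (nat \<Rightarrow> nat) multiset \<Rightarrow> (nat \<Rightarrow> nat) multiset \<Rightarrow> bool" where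
  "Des_equiv n A B \<longleftrightarrow>
     (\<exists>\<Psi>. bij_betw \<Psi> (copies A) (copies B) \<and>
          (\<forall>c \<in> copies A. Des n (fst (\<Psi> c)) = Des n (fst c)))"

definition D_commutative ::
  "nat \<Rightarrow> (nat \<Rightarrow> nat) multiset \<Rightarrow> (nat \<Rightarrow> nat) multiset \<Rightarrow> bool" where
  "D_commutative n A B \<longleftrightarrow> Des_equiv n (mset_mult A B) (mset_mult B A)"

definition is_composition :: "nat \<Rightarrow> nat list \<Rightarrow> bool" where
  "is_composition n \<alpha> \<longleftrightarrow> 0 \<notin> set \<alpha> \<and> sum_list \<alpha> = n"

definition co :: "nat \<Rightarrow> nat set \<Rightarrow> nat list" where
  "co n J = (let js = sorted_list_of_set J in map2 (-) (js @ [n]) (0 # js))"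

definition co_sim :: "nat \<Rightarrow> nat set \<Rightarrow> nat set \<Rightarrow> bool" where
  "co_sim n J K \<longleftrightarrow> mset (co n J) = mset (co n K)"

definition refines :: "nat list \<Rightarrow> nat list \<Rightarrow> bool" where
  "refines \<beta> \<alpha> \<longleftrightarrow> (\<exists>bs. [] \<notin> set bs \<and> concat bs = \<beta> \<and> map sum_list bs = \<alpha>)"

text \<open>
  A formal power series is given by its coefficient function on monomials, a monomial being the
  finitely supported function of its exponents.  The variables are indexed by \<^typ>\<open>nat\<close>, so the
  variable with index \<open>i\<close> stands for $x_{i+1}$.
\<close>

type_synonym monomial = "nat \<Rightarrow>\<^sub>0 nat"
type_synonym series = "monomial \<Rightarrow> int"

definition monom_of :: "nat list \<Rightarrow> nat list \<Rightarrow> monomial" where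
  "monom_of is \<alpha> = (\<Sum>k<length \<alpha>. Poly_Mapping.single (is ! k) (\<alpha> ! k))"

text \<open>
  The coefficient of \<open>m\<close> in $M_\alpha$ is the number of index sequences $i_1 < \dots < i_p$
  whose term is \<open>m\<close>.
\<close>

definition M_qsym :: "nat list \<Rightarrow> series" where
  "M_qsym \<alpha> m =
     int (card {is. length is = length \<alpha> \<and> sorted_wrt (<) is \<and> monom_of is \<alpha> = m})"

definition F_qsym :: "nat list \<Rightarrow> series" where
  "F_qsym \<alpha> m = (\<Sum>\<beta> | is_composition (sum_list \<alpha>) \<beta> \<and> refines \<beta> \<alpha>. M_qsym \<beta> m)"

definition Q_qsym :: "nat \<Rightarrow> (nat \<Rightarrow> nat) multiset \<Rightarrow> series" where
  "Q_qsym n B m = (\<Sum>\<pi>\<in>#B. F_qsym (co n (Des n \<pi>)) m)"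

text \<open>
  Substituting the variable \<open>\<sigma> i\<close> for the variable \<open>i\<close>: the monomial with exponents \<open>e\<close> becomes
  the one with exponents \<open>e \<circ> inv \<sigma>\<close>, so the new coefficient at \<open>m\<close> is the old one at \<open>m \<circ> \<sigma>\<close>.
\<close>

definition permute_vars :: "(nat \<Rightarrow> nat) \<Rightarrow> series \<Rightarrow> series" where
  "permute_vars \<sigma> f m = f (Poly_Mapping.map_key \<sigma> m)"

definition symmetric_series :: "series \<Rightarrow> bool" where
  "symmetric_series f \<longleftrightarrow> (\<forall>\<sigma>. bij \<sigma> \<longrightarrow> permute_vars \<sigma> f = f)"

definition symmetric_mset :: "nat \<Rightarrow> (nat \<Rightarrow> nat) multiset \<Rightarrow> bool" where
  "symmetric_mset n B \<longleftrightarrow> symmetric_series (Q_qsym n B)"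

lemma finite_compositions: "finite {\<alpha>. is_composition n \<alpha>}"
proof (rule finite_subset)
  show "{\<alpha>. is_composition n \<alpha>} \<subseteq> {\<alpha>. set \<alpha> \<subseteq> {..n} \<and> length \<alpha> \<le> n}"
  proof (clarify, rule conjI)
    fix \<alpha> assume a: "is_composition n \<alpha>"
    show "set \<alpha> \<subseteq> {..n}"
      using a member_le_sum_list by (fastforce simp: is_composition_def)
    have "0 \<notin> set \<beta> \<Longrightarrow> length \<beta> \<le> sum_list \<beta>" for \<beta> :: "nat list"
      by (induction \<beta>) auto
    then show "length \<alpha> \<le> n" using a by (auto simp: is_composition_def)
  qed
  show "finite {\<alpha>. set \<alpha> \<subseteq> {..n} \<and> length \<alpha> \<le> n}"
    by (rule finite_lists_length_le) simp
qed

lemma finite_M_qsym_indices: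
  assumes "0 \<notin> set \<alpha>"
  shows "finite {is. length is = length \<alpha> \<and> sorted_wrt (<) is \<and> monom_of is \<alpha> = m}"
proof (rule finite_subset)
  show "{is. length is = length \<alpha> \<and> sorted_wrt (<) is \<and> monom_of is \<alpha> = m}
        \<subseteq> {is. set is \<subseteq> Poly_Mapping.keys m \<and> length is = length \<alpha>}"
  proof clarify
    fix "is" :: "nat list" and x :: nat
    assume l: "length is = length \<alpha>" and x: "x \<in> set is"
    then obtain k where k: "k < length \<alpha>" "x = is ! k"
      by (metis in_set_conv_nth)
    have "\<alpha> ! k > 0" using assms k by (metis gr0I nth_mem)
    then have pos: "0 < Poly_Mapping.lookup (Poly_Mapping.single (is ! k) (\<alpha> ! k)) x"
      using k by simp
    have "0 < (\<Sum>j<length \<alpha>. Poly_Mapping.lookup (Poly_Mapping.single (is ! j) (\<alpha> ! j)) x)"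
      by (rule sum_pos2[of _ k]) (use k pos in simp_all)
    then show "x \<in> Poly_Mapping.keys (monom_of is \<alpha>)"
      by (simp add: in_keys_iff monom_of_def Poly_Mapping.lookup_sum
          del: sum_eq_0_iff)
  qed
  show "finite {is. set is \<subseteq> Poly_Mapping.keys m \<and> length is = length \<alpha>}"
    by (rule finite_lists_length_eq) simp
qed

definition ordered_set_partition :: "nat \<Rightarrow> nat set list \<Rightarrow> bool" where
  "ordered_set_partition n U \<longleftrightarrow> distinct U \<and> partition_on {1..n} (set U)"

definition is_delta :: "nat \<Rightarrow> nat set list \<Rightarrow> (nat \<Rightarrow> nat) \<Rightarrow> bool" where
  "is_delta n U d \<longleftrightarrow> d permutes {1..n} \<and>
     (\<forall>i<length U. strict_mono_on (U ! i) d \<and>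
        d ` (U ! i) = {(\<Sum>j<i. card (U ! j))<..(\<Sum>j\<le>i. card (U ! j))})"

definition delta :: "nat \<Rightarrow> nat set list \<Rightarrow> (nat \<Rightarrow> nat)" where
  "delta n U = (THE d. is_delta n U d)"

definition set_star :: "nat set \<Rightarrow> nat set" where
  "set_star S = {i \<in> S. i + 1 \<in> S}"

definition partition_star :: "nat set list \<Rightarrow> nat set" where
  "partition_star U = (\<Union>S \<in> set U. set_star S)"

definition D_symmetric :: "nat \<Rightarrow> (nat \<Rightarrow> nat) multiset \<Rightarrow> bool" where
  "D_symmetric n B \<longleftrightarrow>
     (\<forall>U. ordered_set_partition n U \<longrightarrow>
        (\<exists>\<Psi>. bij_betw \<Psi> (copies B) (copies B) \<and>
             (\<forall>u \<in> partition_star U. \<forall>c \<in> copies B.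
                u \<in> Des n (fst c) \<longleftrightarrow> delta n U u \<in> Des n (fst (\<Psi> c)))))"

lemma strict_mono_on_onto_interval:
  fixes d :: "nat \<Rightarrow> nat"
  assumes "finite A" "strict_mono_on A d" "d ` A = {s<..t}" "u \<in> A"
  shows "d u = s + card {v \<in> A. v \<le> u}"
proof -
  have inj: "inj_on d A" using assms(2) by (rule strict_mono_on_imp_inj_on)
  have iff: "d v \<le> d u \<longleftrightarrow> v \<le> u" if "v \<in> A" for v
    using strict_mono_onD[OF assms(2) that \<open>u \<in> A\<close>]
      strict_mono_onD[OF assms(2) \<open>u \<in> A\<close> that]
    by (metis leD le_less_linear nat_less_le order_refl)
  have du: "d u \<in> {s<..t}" using assms(3,4) by blast
  have "d ` {v \<in> A. v \<le> u} = {x \<in> d ` A. x \<le> d u}" using iff by auto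
  also have "\<dots> = {s<..d u}" using du by (auto simp: assms(3))
  finally have "card {s<..d u} = card {v \<in> A. v \<le> u}"
    using inj by (metis (no_types, lifting) card_image inj_on_subset mem_Collect_eq subsetI)
  then show ?thesis using du by (simp only: card_greaterThanAtMost) auto
qed

lemma delta_ex1:
  assumes U: "ordered_set_partition n U"
  shows "\<exists>!d. is_delta n U d"
proof -
  define s where "s i = (\<Sum>j<i. card (U ! j))" for i
  have sSuc: "(\<Sum>j\<le>i. card (U ! j)) = s (Suc i)" for i
    by (simp add: s_def lessThan_Suc_atMost)
  have s_step: "s (Suc i) = s i + card (U ! i)" for i by (simp add: s_def)
  have un: "\<Union>(set U) = {1..n}" and dj: "disjoint (set U)" and di: "distinct U"
    using U by (auto simp: ordered_set_partition_def partition_on_def)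
  have sub: "U ! i \<subseteq> {1..n}" if "i < length U" for i using un that nth_mem by blast
  have fin: "finite (U ! i)" if "i < length U" for i
    using sub[OF that] finite_subset by blast
  have blk: "\<exists>i<length U. u \<in> U ! i" if "u \<in> {1..n}" for u
    using that un by (metis Union_iff in_set_conv_nth)
  have disj: "i = j" if "i < length U" "j < length U" "u \<in> U ! i" "u \<in> U ! j" for i j u
    using that dj di unfolding disjoint_def
    by (metis disjoint_iff nth_eq_iff_index_eq nth_mem)
  define b where "b u = (THE i. i < length U \<and> u \<in> U ! i)" for u
  have b: "b u = i" if "i < length U" "u \<in> U ! i" for u i
    unfolding b_def using that disj by (intro the_equality) auto
  define d where
    "d u = (if u \<in> {1..n} then s (b u) + card {v \<in> U ! b u. v \<le> u} else u)" for u
  have d: "d u = s i + card {v \<in> U ! i. v \<le> u}" if "i < length U" "u \<in> U ! i" for u i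
    using b[OF that] subsetD[OF sub[OF that(1)] that(2)] by (simp add: d_def)
  have mono: "strict_mono_on (U ! i) d" if i: "i < length U" for i
  proof (rule strict_mono_onI)
    fix r t assume rt: "r \<in> U ! i" "t \<in> U ! i" "r < t"
    have "{v \<in> U ! i. v \<le> r} \<subseteq> {v \<in> U ! i. v \<le> t}"
      and "t \<in> {v \<in> U ! i. v \<le> t}" and "t \<notin> {v \<in> U ! i. v \<le> r}"
      using rt by auto
    then have "{v \<in> U ! i. v \<le> r} \<subset> {v \<in> U ! i. v \<le> t}" by blast
    then have "card {v \<in> U ! i. v \<le> r} < card {v \<in> U ! i. v \<le> t}"
      using fin[OF i] by (intro psubset_card_mono) auto
    then show "d r < d t" using d[OF i] rt by simp
  qed
  have img: "d ` (U ! i) = {s i<..s (Suc i)}" if i: "i < length U" for i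
  proof (rule card_subset_eq)
    show "d ` (U ! i) \<subseteq> {s i<..s (Suc i)}"
    proof clarify
      fix u assume u: "u \<in> U ! i"
      have "0 < card {v \<in> U ! i. v \<le> u}" using u fin[OF i] by (auto simp: card_gt_0_iff)
      moreover have "card {v \<in> U ! i. v \<le> u} \<le> card (U ! i)"
        using fin[OF i] by (intro card_mono) auto
      ultimately show "d u \<in> {s i<..s (Suc i)}" using d[OF i u] s_step by simp
    qed
    show "card (d ` (U ! i)) = card {s i<..s (Suc i)}"
      using card_image[OF strict_mono_on_imp_inj_on[OF mono[OF i]]] s_step by simp
  qed simp
  have ints: "(\<Union>i<k. {s i<..s (Suc i)}) = {0<..s k}" for k
  proof (induction k)
    case 0 then show ?case by (simp add: s_def)
  next
    case (Suc k)
    have "(\<Union>i<Suc k. {s i<..s (Suc i)}) = {0<..s k} \<union> {s k<..s (Suc k)}"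
      using Suc by (simp add: lessThan_Suc Un_commute)
    also have "\<dots> = {0<..s (Suc k)}" using s_step[of k] by auto
    finally show ?case .
  qed
  have UN: "{1..n} = (\<Union>i<length U. U ! i)" using sub blk by blast
  have "n = card (\<Union>i<length U. U ! i)" using UN[symmetric] by simp
  also have "\<dots> = s (length U)"
    unfolding s_def using fin disj by (intro card_UN_disjoint) auto
  finally have sn: "s (length U) = n" ..
  have dimg: "d ` {1..n} = {1..n}"
  proof -
    have "d ` {1..n} = (\<Union>i<length U. d ` (U ! i))" unfolding UN by blast
    also have "\<dots> = {0<..n}" using img ints[of "length U"] sn by simp
    finally show ?thesis by auto
  qed
  have "d permutes {1..n}"
  proof (rule bij_imp_permutes)
    show "bij_betw d {1..n} {1..n}"
      using dimg by (simp add: bij_betw_def eq_card_imp_inj_on)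
  qed (simp add: d_def del: atLeastAtMost_iff)
  then have ex: "is_delta n U d"
    using mono img by (simp add: is_delta_def sSuc flip: s_def)
  have uniq: "e = d" if e: "is_delta n U e" for e
  proof
    fix u
    show "e u = d u"
    proof (cases "u \<in> {1..n}")
      case True
      then obtain i where i: "i < length U" "u \<in> U ! i" using blk by blast
      have "strict_mono_on (U ! i) e" "e ` (U ! i) = {s i<..s (Suc i)}"
        using e i by (simp_all add: is_delta_def sSuc flip: s_def)
      from strict_mono_on_onto_interval[OF fin[OF i(1)] this i(2)] d[OF i]
      show ?thesis by simp
    next
      case False
      then show ?thesis using e
        by (simp add: is_delta_def permutes_def d_def del: atLeastAtMost_iff)
    qed
  qed
  from ex uniq show ?thesis by blast
qed

end

theory Submission
  imports Defs "HOL-Library.Product_Lexorder"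
begin

text \<open>
  For a multiset \<open>B\<close> of permutations let \<open>Des_count n B D\<close> be the number of its elements with descent
  set inside \<open>D\<close>.  By Moebius inversion these numbers determine the distribution of descent sets.
  Each of the five conditions is equivalent to \<open>Des_count_symmetric n B\<close>: the number
  \<open>Des_count n B J\<close> depends only on the multiset of parts of \<open>co n J\<close>.

  Symmetric functions.  A monomial of degree \<open>n\<close> with exponents \<open>co n J\<close>, in the order of the
  variables, has coefficient \<open>Des_count n B J\<close> in \<open>Q_qsym n B\<close>, because it occurs in the fundamental
  function of \<open>co n D\<close> exactly if \<open>D \<subseteq> J\<close>.  Permuting the variables rearranges the exponents
  (\<open>symmetric_mset_iff\<close>).

  D-symmetry.  For \<open>S\<close> inside \<open>partition_star U\<close>, the permutation \<open>delta n U\<close> moves each interval cut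
  out by the complement of \<open>S\<close> rigidly, so the complements of \<open>S\<close> and of its image give the same parts
  in another order.  Every rearrangement arises by permuting whole blocks.  The bijections asked for
  exist exactly if \<open>Des_count n B\<close> agrees at all such pairs of complements
  (\<open>D_symmetric_iff\<close>, \<open>co_sim_delta\<close>, \<open>co_sim_imp_delta\<close>).

  Products.  Fix \<open>\<pi>\<close>.  The products of an element of the inverse class of \<open>J\<close> with \<open>\<pi>\<close> whose descent
  set lies in \<open>K\<close> correspond to the matrices of natural numbers with row sums \<open>co n K\<close> and column sums
  \<open>co n J\<close> such that the entries, read row by row, form a composition whose set contains \<open>Des n \<pi>\<close>
  (\<open>card_eq_card_pair_msets\<close>).  Summing over \<open>B\<close>, the statistic of the product at \<open>K\<close> is the sum of
  \<open>Des_count n B\<close> over the row readings of these matrices.  For products in the other order, rows and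
  columns exchange their roles.  If \<open>Des_count n B\<close> does not see the order of the parts, then
  permuting rows or columns and transposing do not change the sum, which gives all three conditions
  on products.  Conversely, \<open>K = {}\<close> forces the product to be the identity, and the sum is
  \<open>Des_count n B J\<close>, so invariance under rearranging \<open>J\<close> yields the symmetry at once.  From
  commutation it follows by downward induction on the number of parts, by comparing row readings with
  column readings (\<open>Des_count_symmetric_if_commutes\<close>).
\<close>

section \<open>Sorted words of multisets\<close>

definition word :: "'a::linorder multiset \<Rightarrow> nat \<Rightarrow> 'a" where
  "word X i = sorted_list_of_multiset X ! (i - 1)"

text \<open>
  A nonempty multiset of size \<open>n\<close>, arranged in increasing order, cuts the positions
  \<open>{1..n}\<close> into runs of equal elements.  The lengths of the runs are the multiplicities, so subsets
  of \<open>{1..n - 1}\<close>, that is compositions of \<open>n\<close>, can be handled as multisets, and rearranging a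
  composition becomes renaming the elements of a multiset.
\<close>

definition breaks :: "'a::linorder multiset \<Rightarrow> nat set" where
  "breaks X = {i \<in> {1..size X - 1}. word X i \<noteq> word X (i + 1)}"

lemma length_sorted_list_of_multiset: "length (sorted_list_of_multiset X) = size X"
  by (metis mset_sorted_list_of_multiset size_mset)

lemma word_mono: "mono_on {1..size X} (word X)"
proof (rule mono_onI)
  fix i j assume "i \<in> {1..size X}" "j \<in> {1..size X}" "i \<le> j"
  then show "word X i \<le> word X j"
    using sorted_nth_mono[OF sorted_sorted_list_of_multiset, of "i - 1" "j - 1" X]
    by (auto simp: word_def length_sorted_list_of_multiset)
qed

text \<open>
  An increasing function is determined by the multiset of its values.  Several permutations and
  colourings below are identified by this principle.
\<close>

lemma word_unique:
  assumes "mono_on {1..n} f" "image_mset f (mset_set {1..n}) = X" "i \<in> {1..n}"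
  shows "word X i = f i"
proof -
  have "sorted (map f [1..<Suc n])"
    using assms(1) by (auto simp: sorted_iff_nth_mono mono_on_def simp del: upt_Suc)
  moreover have "mset (map f [1..<Suc n]) = X"
    using assms(2) by (simp add: atLeastLessThanSuc_atLeastAtMost del: upt_Suc)
  ultimately have "sorted_list_of_multiset X = map f [1..<Suc n]"
    by (metis sorted_list_of_multiset_mset sorted_sort_id)
  then show ?thesis using assms(3) by (auto simp: word_def simp del: upt_Suc)
qed

lemma image_mset_word: "image_mset (word X) (mset_set {1..size X}) = X"
proof -
  have "map (word X) [1..<Suc (size X)] = sorted_list_of_multiset X"
    by (rule nth_equalityI)
      (auto simp: word_def length_sorted_list_of_multiset simp del: upt_Suc)
  then have "mset (map (word X) [1..<Suc (size X)]) = X" by simp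
  then show ?thesis by (simp add: atLeastLessThanSuc_atLeastAtMost del: upt_Suc)
qed

lemma word_in: "i \<in> {1..size X} \<Longrightarrow> word X i \<in># X"
  by (metis (no_types) finite_atLeastAtMost finite_set_mset_mset_set image_eqI image_mset_word set_image_mset)

lemma breaks_unique:
  assumes "mono_on {1..n} f" "image_mset f (mset_set {1..n}) = X"
  shows "breaks X = {i \<in> {1..n - 1}. f i \<noteq> f (i + 1)}"
proof -
  have "size X = n" using assms(2) by auto
  moreover have "word X i = f i" "word X (i + 1) = f (i + 1)" if "i \<in> {1..n - 1}" for i
    using that by (auto intro!: word_unique[OF assms])
  ultimately show ?thesis by (auto simp: breaks_def)
qed

lemma breaks_subset: "breaks X \<subseteq> {1..size X - 1}"
  by (auto simp: breaks_def)

section \<open>Blocks of consecutive positions\<close>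

text \<open>
  The blocks are the maximal intervals that contain no step from \<open>j\<close> to \<open>j + 1\<close> with \<open>j \<in> J\<close>,
  numbered from \<open>0\<close> on the left; their lengths are the parts of \<open>co n J\<close>.
\<close>

definition block_of :: "nat set \<Rightarrow> nat \<Rightarrow> nat" where
  "block_of J i = card {j \<in> J. j < i}"

text \<open>
  The multiset with break set \<open>J\<close> whose elements are the block numbers.
\<close>

definition block_mset :: "nat \<Rightarrow> nat set \<Rightarrow> nat multiset" where
  "block_mset n J = image_mset (block_of J) (mset_set {1..n})"

lemma size_block_mset [simp]: "size (block_mset n J) = n"
  by (simp add: block_mset_def)

lemma block_of_mono: "i \<le> j \<Longrightarrow> block_of J i \<le> block_of J j"
  unfolding block_of_def by (rule card_mono) auto

lemma block_of_Suc: "block_of J (i + 1) = block_of J i + (if i \<in> J then 1 else 0)"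
proof -
  have "{j \<in> J. j < i + 1} = {j \<in> J. j < i} \<union> (if i \<in> J then {i} else {})"
    by (auto simp: less_Suc_eq)
  then show ?thesis by (simp add: block_of_def)
qed

lemma word_block_mset: "i \<in> {1..n} \<Longrightarrow> word (block_mset n J) i = block_of J i"
  by (rule word_unique[of n]) (auto simp: block_mset_def mono_on_def block_of_mono)

lemma breaks_block_mset: "J \<subseteq> {1..n - 1} \<Longrightarrow> breaks (block_mset n J) = J"
  by (subst breaks_unique[of n "block_of J"])
    (auto simp: block_mset_def mono_on_def block_of_mono block_of_Suc[simplified])

text \<open>
  Two positions in the same block are joined by steps that avoid \<open>J\<close>.
\<close>

lemma constant_on_blocks:
  assumes "\<And>w. w \<in> {1..n - 1} \<Longrightarrow> w \<notin> J \<Longrightarrow> f (w + 1) = f w"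
    and "u \<in> {1..n}" "v \<in> {1..n}" "block_of J u = block_of J v"
  shows "f u = f v"
proof -
  have *: "f u = f v" if "u \<le> v" "1 \<le> u" "v \<le> n" "block_of J u = block_of J v" for u v
    using that
  proof (induction v rule: dec_induct)
    case (step v)
    have "block_of J u \<le> block_of J v" "block_of J v \<le> block_of J (Suc v)"
      using step.hyps by (simp_all add: block_of_mono)
    then have eq: "block_of J v = block_of J u" "block_of J (Suc v) = block_of J v"
      using step.prems by linarith+
    then have "v \<notin> J" using block_of_Suc[of J v] by (auto split: if_splits)
    then have "f (v + 1) = f v" using step.hyps step.prems by (intro assms(1)) auto
    moreover have "f u = f v" by (rule step.IH) (use step.prems eq in linarith)+
    ultimately show ?case by simp
  qed simp
  consider "u \<le> v" | "v \<le> u" by linarith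
  then show ?thesis
  proof cases
    case 1
    show ?thesis by (rule *) (use 1 assms(2-4) in simp_all)
  next
    case 2
    show ?thesis by (rule *[symmetric]) (use 2 assms(2-4) in simp_all)
  qed
qed

text \<open>
  The ranking sends \<open>i\<close> to the number of positions whose value is at most \<open>f i\<close>.
\<close>

lemma exists_ranking:
  fixes f :: "nat \<Rightarrow> 'a::linorder"
  assumes inj: "inj_on f {1..n}"
  shows "\<exists>\<sigma>. \<sigma> permutes {1..n} \<and> (\<forall>i\<in>{1..n}. \<forall>j\<in>{1..n}. \<sigma> i < \<sigma> j \<longleftrightarrow> f i < f j)"
proof -
  define \<sigma> where "\<sigma> i = (if i \<in> {1..n} then card {k \<in> {1..n}. f k \<le> f i} else i)" for i
  have less: "\<sigma> i < \<sigma> j" if "i \<in> {1..n}" "j \<in> {1..n}" "f i < f j" for i j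
  proof -
    have "{k \<in> {1..n}. f k \<le> f i} \<subset> {k \<in> {1..n}. f k \<le> f j}"
    proof (rule psubsetI)
      show "{k \<in> {1..n}. f k \<le> f i} \<subseteq> {k \<in> {1..n}. f k \<le> f j}" using that by auto
      have "j \<in> {k \<in> {1..n}. f k \<le> f j}" "j \<notin> {k \<in> {1..n}. f k \<le> f i}" using that by auto
      then show "{k \<in> {1..n}. f k \<le> f i} \<noteq> {k \<in> {1..n}. f k \<le> f j}" by blast
    qed
    then have "card {k \<in> {1..n}. f k \<le> f i} < card {k \<in> {1..n}. f k \<le> f j}"
      by (intro psubset_card_mono) simp_all
    then show ?thesis using that(1,2) by (simp only: \<sigma>_def if_True)
  qed
  have iff: "\<sigma> i < \<sigma> j \<longleftrightarrow> f i < f j" if "i \<in> {1..n}" "j \<in> {1..n}" for i j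
  proof (cases "f i" "f j" rule: linorder_cases)
    case equal
    then have "i = j" using inj_onD[OF inj] that by blast
    then show ?thesis by simp
  qed (use less[of i j] less[of j i] that in auto)
  have "inj_on \<sigma> {1..n}"
  proof (rule inj_onI)
    fix i j assume ij: "i \<in> {1..n}" "j \<in> {1..n}" "\<sigma> i = \<sigma> j"
    then have "f i = f j" using less[of i j] less[of j i] by (cases "f i" "f j" rule: linorder_cases) auto
    then show "i = j" using inj_onD[OF inj] ij by blast
  qed
  moreover have "\<sigma> ` {1..n} \<subseteq> {1..n}"
  proof clarify
    fix i assume i: "i \<in> {1..n}"
    then have "0 < card {k \<in> {1..n}. f k \<le> f i}" by (auto simp: card_gt_0_iff)
    moreover have "card {k \<in> {1..n}. f k \<le> f i} \<le> card {1..n}" by (rule card_mono) auto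
    ultimately show "\<sigma> i \<in> {1..n}" using i by (simp add: \<sigma>_def)
  qed
  ultimately have "bij_betw \<sigma> {1..n} {1..n}"
    by (simp add: bij_betw_def endo_inj_surj)
  then have "\<sigma> permutes {1..n}" by (rule bij_imp_permutes) (auto simp: \<sigma>_def)
  with iff show ?thesis by blast
qed

lemma ranking_unique:
  fixes \<sigma> \<sigma>' :: "nat \<Rightarrow> nat"
  assumes "\<sigma> permutes {1..n}" "\<sigma>' permutes {1..n}"
    and "\<And>i j. i \<in> {1..n} \<Longrightarrow> j \<in> {1..n} \<Longrightarrow> \<sigma> i < \<sigma> j \<longleftrightarrow> \<sigma>' i < \<sigma>' j"
  shows "\<sigma> = \<sigma>'"
proof
  have rank: "\<tau> i = card {k \<in> {1..n}. \<tau> k < \<tau> i} + 1"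
    if "\<tau> permutes {1..n}" "i \<in> {1..n}"
    for \<tau> :: "nat \<Rightarrow> nat" and i
  proof -
    have ti: "\<tau> i \<in> {1..n}" using that by (simp only: permutes_in_image)
    have "\<tau> ` {k \<in> {1..n}. \<tau> k < \<tau> i} = {x \<in> \<tau> ` {1..n}. x < \<tau> i}" by auto
    also have "\<dots> = {1..<\<tau> i}" using ti unfolding permutes_image[OF that(1)] by auto
    finally have "card {k \<in> {1..n}. \<tau> k < \<tau> i} = card {1..<\<tau> i}"
      using card_image[OF inj_on_subset[OF permutes_inj[OF that(1)] subset_UNIV]] by metis
    then show ?thesis using ti by simp
  qed
  fix i show "\<sigma> i = \<sigma>' i"
  proof (cases "i \<in> {1..n}")
    case True
    then have "{k \<in> {1..n}. \<sigma> k < \<sigma> i} = {k \<in> {1..n}. \<sigma>' k < \<sigma>' i}" using assms(3) by auto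
    then show ?thesis using rank[OF assms(1) True] rank[OF assms(2) True] by simp
  next
    case False
    then show ?thesis using assms(1,2) by (metis permutes_not_in)
  qed
qed

lemma strict_mono_off_breaks:
  assumes "Des n \<pi> \<subseteq> J" "\<pi> permutes {1..n}" "i \<in> {1..n}" "j \<in> {1..n}" "i < j"
    "block_of J i = block_of J j"
  shows "\<pi> i < \<pi> j"
proof -
  have up: "\<pi> k < \<pi> (k + 1)" if "k \<in> {1..n - 1}" "k \<notin> J" for k
  proof -
    have "\<pi> k \<noteq> \<pi> (k + 1)" using inj_eq[OF permutes_inj[OF assms(2)]] by simp
    then show ?thesis using that assms(1) by (fastforce simp: Des_def)
  qed
  have "Suc i \<le> j" "1 \<le> i" "j \<le> n" using assms by auto
  then show ?thesis using assms(6)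
  proof (induction j rule: dec_induct)
    case base
    then show ?case using up[of i] block_of_Suc[of J i] by (auto split: if_splits)
  next
    case (step j)
    have "block_of J i \<le> block_of J j" "block_of J j \<le> block_of J (Suc j)"
      using step.hyps by (simp_all add: block_of_mono)
    then have eq: "block_of J i = block_of J j" "block_of J (Suc j) = block_of J j"
      using step.prems by linarith+
    then have "j \<notin> J" using block_of_Suc[of J j] by (auto split: if_splits)
    then have "\<pi> j < \<pi> (j + 1)" using step.hyps step.prems(2) \<open>1 \<le> i\<close> by (intro up) auto
    moreover have "\<pi> i < \<pi> j" by (rule step.IH) (use step.prems eq in linarith)+
    ultimately show ?case by simp
  qed
qed


section \<open>Factorizations of a permutation and matrices\<close>

text \<open>
  A multiset of pairs is a matrix of natural numbers, the multiplicity of \<open>(k, j)\<close> being the entry in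
  row \<open>k\<close> and column \<open>j\<close>.  The conditions say that its row sums are the parts of \<open>co n K\<close> and its
  column sums the parts of \<open>co n J\<close>.  Pairs are ordered lexicographically, so the break set of the
  multiset corresponds to the composition that is read off the nonzero entries row by row.
\<close>

definition pair_msets :: "nat \<Rightarrow> nat set \<Rightarrow> nat set \<Rightarrow> (nat \<times> nat) multiset set" where
  "pair_msets n K J = {M. image_mset fst M = block_mset n K \<and> image_mset snd M = block_mset n J}"

lemma image_mset_comp_permutes:
  assumes "\<sigma> permutes A"
  shows "image_mset (\<lambda>i. h (\<sigma> i)) (mset_set A) = image_mset h (mset_set A)"
  using permutes_image_mset[OF assms] by (metis (no_types, lifting) comp_apply image_mset_cong multiset.map_comp)

text \<open>
  Colour position \<open>i\<close> by the \<open>J\<close>-block of \<open>\<sigma> i\<close>.  Colours increase with \<open>\<sigma>\<close>, and inside one colour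
  the hypothesis makes \<open>\<sigma>\<close> order the positions as \<open>\<pi>\<close> does.  Hence \<open>\<sigma>\<close> is determined by its
  colouring: it ranks the positions by colour first and by \<open>\<pi>\<close> second.
\<close>

lemma ranking_of_block_colouring:
  assumes "\<pi> permutes {1..n}" "\<sigma> permutes {1..n}" "Des n (\<pi> \<circ> inv \<sigma>) \<subseteq> J"
    and ij: "i \<in> {1..n}" "j \<in> {1..n}"
  shows "\<sigma> i < \<sigma> j \<longleftrightarrow> (block_of J (\<sigma> i), \<pi> i) < (block_of J (\<sigma> j), \<pi> j)"
proof -
  have up: "(block_of J (\<sigma> i), \<pi> i) < (block_of J (\<sigma> j), \<pi> j)"
    if "\<sigma> i < \<sigma> j" "i \<in> {1..n}" "j \<in> {1..n}" for i j
  proof (cases "block_of J (\<sigma> i) = block_of J (\<sigma> j)")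
    case True
    have "(\<pi> \<circ> inv \<sigma>) (\<sigma> i) < (\<pi> \<circ> inv \<sigma>) (\<sigma> j)"
    proof (rule strict_mono_off_breaks[OF assms(3)])
      show "\<pi> \<circ> inv \<sigma> permutes {1..n}"
        using assms(1,2) by (intro permutes_compose permutes_inv)
      show "\<sigma> i \<in> {1..n}" "\<sigma> j \<in> {1..n}"
        using that(2,3) by (simp_all only: permutes_in_image[OF assms(2)])
    qed (use that True in auto)
    then show ?thesis using True by (simp add: permutes_inverses[OF assms(2)])
  next
    case False
    then show ?thesis using block_of_mono[of "\<sigma> i" "\<sigma> j" J] that by simp
  qed
  show ?thesis
  proof (cases "\<sigma> i" "\<sigma> j" rule: linorder_cases)
    case equal
    then have "i = j" using inj_eq[OF permutes_inj[OF assms(2)]] by simp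
    then show ?thesis by simp
  qed (use up[of i j] up[of j i] ij in auto)
qed

text \<open>
  The matrix of \<open>\<sigma>\<close> counts the positions of each \<open>K\<close>-block that \<open>\<sigma>\<close> sends to each \<open>J\<close>-block.
\<close>

definition pair_mset_of :: "nat \<Rightarrow> nat set \<Rightarrow> nat set \<Rightarrow> (nat \<Rightarrow> nat) \<Rightarrow> (nat \<times> nat) multiset" where
  "pair_mset_of n K J \<sigma> =
    image_mset (\<lambda>i. (block_of K i, block_of J (\<sigma> i))) (mset_set {1..n})"

text \<open>
  As \<open>\<sigma>\<close> increases on each \<open>K\<close>-block, so do the colours; the pairs therefore come already sorted, and
  the colouring can be recovered from the matrix.
\<close>

lemma mono_on_pairs:
  assumes "\<sigma> permutes {1..n}" "Des n \<sigma> \<subseteq> K"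
  shows "mono_on {1..n} (\<lambda>i. (block_of K i, block_of J (\<sigma> i)))"
proof (rule mono_onI)
  fix i j assume ij: "i \<in> {1..n}" "j \<in> {1..n}" "i \<le> j"
  show "(block_of K i, block_of J (\<sigma> i)) \<le> (block_of K j, block_of J (\<sigma> j))"
  proof (cases "i < j \<and> block_of K i = block_of K j")
    case True
    then have "\<sigma> i < \<sigma> j" using ij by (intro strict_mono_off_breaks[OF assms(2,1)]) auto
    then show ?thesis using True block_of_mono[of "\<sigma> i" "\<sigma> j" J] by simp
  next
    case False
    then show ?thesis using ij block_of_mono[of i j K] by (cases "i = j") auto
  qed
qed

lemma word_pair_mset_of:
  assumes "\<sigma> permutes {1..n}" "Des n \<sigma> \<subseteq> K" "i \<in> {1..n}"
  shows "word (pair_mset_of n K J \<sigma>) i = (block_of K i, block_of J (\<sigma> i))"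
  using assms by (intro word_unique[OF mono_on_pairs]) (auto simp: pair_mset_of_def)

text \<open>
  Where neither the \<open>K\<close>-block nor the colour changes from \<open>i\<close> to \<open>i + 1\<close>, the permutation \<open>\<sigma>\<close>
  increases, and within one colour \<open>\<pi>\<close> is ordered as \<open>\<sigma>\<close>; so \<open>\<pi>\<close> has no descent there.
\<close>

lemma pair_mset_of_in:
  assumes \<pi>: "\<pi> permutes {1..n}" and \<sigma>: "\<sigma> permutes {1..n}"
    and "Des n \<sigma> \<subseteq> K" "Des n (\<pi> \<circ> inv \<sigma>) \<subseteq> J"
  shows "pair_mset_of n K J \<sigma> \<in> pair_msets n K J"
    and "Des n \<pi> \<subseteq> breaks (pair_mset_of n K J \<sigma>)"
proof -
  show "pair_mset_of n K J \<sigma> \<in> pair_msets n K J"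
    using image_mset_comp_permutes[OF \<sigma>, of "block_of J"]
    by (simp add: pair_msets_def pair_mset_of_def block_mset_def image_mset.compositionality comp_def)
  show "Des n \<pi> \<subseteq> breaks (pair_mset_of n K J \<sigma>)"
  proof
    fix i assume i: "i \<in> Des n \<pi>"
    then have ij: "i \<in> {1..n}" "i + 1 \<in> {1..n}" "\<pi> (i + 1) < \<pi> i" "i \<in> {1..n - 1}"
      by (auto simp: Des_def)
    have "block_of J (\<sigma> i) \<noteq> block_of J (\<sigma> (i + 1))" if "i \<notin> K"
    proof
      assume eq: "block_of J (\<sigma> i) = block_of J (\<sigma> (i + 1))"
      have "\<sigma> i < \<sigma> (i + 1)"
        using that ij by (intro strict_mono_off_breaks[OF assms(3) \<sigma>]) (auto simp: block_of_Suc[simplified])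
      then have "\<pi> i < \<pi> (i + 1)"
        using ranking_of_block_colouring[OF \<pi> \<sigma> assms(4) ij(1,2)] eq by simp
      then show False using ij(3) by simp
    qed
    then have "(block_of K i, block_of J (\<sigma> i)) \<noteq> (block_of K (i + 1), block_of J (\<sigma> (i + 1)))"
      by (auto simp: block_of_Suc[simplified])
    then show "i \<in> breaks (pair_mset_of n K J \<sigma>)"
      using ij(4) by (subst breaks_unique[OF mono_on_pairs[OF \<sigma> assms(3)]]) (simp_all add: pair_mset_of_def)
  qed
qed

text \<open>
  Reading the second components of the sorted matrix gives a colouring, and \<open>\<sigma>\<close> is its ranking, with
  ties broken by \<open>\<pi>\<close>.  The column sums make the colour of a position the \<open>J\<close>-block of its rank.
\<close>

lemma pair_mset_of_surj:
  assumes \<pi>: "\<pi> permutes {1..n}" and M: "M \<in> pair_msets n K J" and D: "Des n \<pi> \<subseteq> breaks M"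
  shows "\<exists>\<sigma>. \<sigma> permutes {1..n} \<and> Des n \<sigma> \<subseteq> K \<and> Des n (\<pi> \<circ> inv \<sigma>) \<subseteq> J \<and> M = pair_mset_of n K J \<sigma>"
proof -
  define c where "c i = snd (word M i)" for i
  have fstM: "image_mset fst M = block_mset n K" and sndM: "image_mset snd M = block_mset n J"
    using M by (auto simp: pair_msets_def)
  have size: "size M = n" using arg_cong[OF fstM, of size] by simp
  have Mw: "M = image_mset (word M) (mset_set {1..n})" using image_mset_word[of M] size by simp
  have wmono: "word M i \<le> word M j" if "i \<in> {1..n}" "j \<in> {1..n}" "i \<le> j" for i j
    using mono_onD[OF word_mono[of M]] that size by simp
  \<comment> \<open>The first components are sorted too, and their content is fixed by the row sums.\<close>
  have fstw: "fst (word M i) = block_of K i" if i: "i \<in> {1..n}" for i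
  proof -
    have "mono_on {1..n} (\<lambda>i. fst (word M i))"
    proof (rule mono_onI)
      fix i j assume "i \<in> {1..n}" "j \<in> {1..n}" "i \<le> j"
      then show "fst (word M i) \<le> fst (word M j)"
        using wmono[of i j] by (auto simp: less_eq_prod_def)
    qed
    moreover have "image_mset (\<lambda>i. fst (word M i)) (mset_set {1..n}) = block_mset n K"
      using fstM arg_cong[OF Mw, of "image_mset fst"] by (simp add: image_mset.compositionality comp_def)
    ultimately show ?thesis using word_unique word_block_mset i by metis
  qed
  have inj: "inj_on (\<lambda>i. (c i, \<pi> i)) {1..n}"
    using permutes_inj[OF \<pi>] by (auto intro!: inj_onI simp: inj_eq)
  obtain \<sigma> where \<sigma>: "\<sigma> permutes {1..n}"
    and rank: "\<And>i j. i \<in> {1..n} \<Longrightarrow> j \<in> {1..n} \<Longrightarrow> \<sigma> i < \<sigma> j \<longleftrightarrow> (c i, \<pi> i) < (c j, \<pi> j)"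
    using exists_ranking[OF inj] by blast
  have inv_in: "inv \<sigma> x \<in> {1..n}" if "x \<in> {1..n}" for x
    using that by (simp only: permutes_in_image[OF permutes_inv[OF \<sigma>]])
  have \<sigma>inv: "\<sigma> (inv \<sigma> x) = x" "inv \<sigma> (\<sigma> x) = x" for x
    using permutes_inverses[OF \<sigma>] by auto
  \<comment> \<open>In order of rank the colours are sorted, and their content is fixed by the column sums.\<close>
  have col: "c (inv \<sigma> x) = block_of J x" if x: "x \<in> {1..n}" for x
  proof -
    have "mono_on {1..n} (\<lambda>x. c (inv \<sigma> x))"
    proof (rule mono_onI)
      fix x y assume xy: "x \<in> {1..n}" "y \<in> {1..n}" "x \<le> y"
      then show "c (inv \<sigma> x) \<le> c (inv \<sigma> y)"
        using rank[of "inv \<sigma> y" "inv \<sigma> x"] inv_in \<sigma>inv by (auto simp: not_less[symmetric])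
    qed
    moreover have "image_mset (\<lambda>x. c (inv \<sigma> x)) (mset_set {1..n}) = block_mset n J"
      using sndM arg_cong[OF Mw, of "image_mset snd"]
      by (subst image_mset_comp_permutes[OF permutes_inv[OF \<sigma>]])
        (simp add: c_def[abs_def] image_mset.compositionality comp_def)
    ultimately show ?thesis using word_unique word_block_mset x by metis
  qed
  have col': "c i = block_of J (\<sigma> i)" if "i \<in> {1..n}" for i
    using col[of "\<sigma> i"] that permutes_in_image[OF \<sigma>] \<sigma>inv by metis
  have "M = image_mset (word M) (mset_set {1..n})" by (rule Mw)
  also have "\<dots> = pair_mset_of n K J \<sigma>"
    unfolding pair_mset_of_def
    by (rule image_mset_cong) (metis c_def col' elem_mset_set finite_atLeastAtMost fstw prod.collapse)
  finally have "M = pair_mset_of n K J \<sigma>" .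
  moreover have "Des n \<sigma> \<subseteq> K"
  proof (rule subsetI, rule ccontr)
    fix i assume i: "i \<in> Des n \<sigma>" and "i \<notin> K"
    then have ij: "i \<in> {1..n}" "i + 1 \<in> {1..n}" "\<sigma> (i + 1) < \<sigma> i" "i \<in> {1..n - 1}"
      by (auto simp: Des_def)
    have "fst (word M i) = fst (word M (i + 1))"
      using fstw[OF ij(1)] fstw[OF ij(2)] \<open>i \<notin> K\<close> by (simp add: block_of_Suc[simplified])
    then have "c i \<le> c (i + 1)" and eq: "word M i = word M (i + 1) \<longleftrightarrow> c i = c (i + 1)"
      using wmono[OF ij(1,2)] by (auto simp: c_def less_eq_prod_def prod_eq_iff)
    moreover have "(c (i + 1), \<pi> (i + 1)) < (c i, \<pi> i)" using rank[OF ij(2,1)] ij(3) by blast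
    ultimately have "c i = c (i + 1)" "\<pi> (i + 1) < \<pi> i" by auto
    then have "i \<notin> breaks M" "i \<in> Des n \<pi>" using eq ij(4) by (auto simp: breaks_def Des_def)
    then show False using D by blast
  qed
  moreover have "Des n (\<pi> \<circ> inv \<sigma>) \<subseteq> J"
  proof (rule subsetI, rule ccontr)
    fix i assume i: "i \<in> Des n (\<pi> \<circ> inv \<sigma>)" and "i \<notin> J"
    then have ij: "i \<in> {1..n}" "i + 1 \<in> {1..n}" "\<pi> (inv \<sigma> (i + 1)) < \<pi> (inv \<sigma> i)"
      by (auto simp: Des_def)
    have "c (inv \<sigma> i) = c (inv \<sigma> (i + 1))"
      using col[OF ij(1)] col[OF ij(2)] \<open>i \<notin> J\<close> by (simp add: block_of_Suc[simplified])
    then have "\<sigma> (inv \<sigma> (i + 1)) < \<sigma> (inv \<sigma> i)"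
      using rank[OF inv_in[OF ij(2)] inv_in[OF ij(1)]] ij(3) by simp
    then show False by (simp add: \<sigma>inv)
  qed
  ultimately show ?thesis using \<sigma> by blast
qed

text \<open>
  The matrix determines the colouring, the colouring determines \<open>\<sigma>\<close>, and every matrix whose row
  reading admits the descents of \<open>\<pi>\<close> arises.
\<close>

lemma card_eq_card_pair_msets:
  assumes \<pi>: "\<pi> permutes {1..n}"
  shows "card {\<sigma>. \<sigma> permutes {1..n} \<and> Des n \<sigma> \<subseteq> K \<and> Des n (\<pi> \<circ> inv \<sigma>) \<subseteq> J} =
         card {M \<in> pair_msets n K J. Des n \<pi> \<subseteq> breaks M}"
proof (rule bij_betw_same_card[of "pair_mset_of n K J"], rule bij_betw_imageI)
  show "inj_on (pair_mset_of n K J) {\<sigma>. \<sigma> permutes {1..n} \<and> Des n \<sigma> \<subseteq> K \<and> Des n (\<pi> \<circ> inv \<sigma>) \<subseteq> J}"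
  proof (rule inj_onI, clarify)
    fix \<sigma> \<tau>
    assume \<sigma>: "\<sigma> permutes {1..n}" "Des n \<sigma> \<subseteq> K" "Des n (\<pi> \<circ> inv \<sigma>) \<subseteq> J"
      and \<tau>: "\<tau> permutes {1..n}" "Des n \<tau> \<subseteq> K" "Des n (\<pi> \<circ> inv \<tau>) \<subseteq> J"
      and eq: "pair_mset_of n K J \<sigma> = pair_mset_of n K J \<tau>"
    have "block_of J (\<sigma> i) = block_of J (\<tau> i)" if "i \<in> {1..n}" for i
      using word_pair_mset_of[OF \<sigma>(1,2) that, of J] word_pair_mset_of[OF \<tau>(1,2) that, of J] eq by simp
    then have "\<sigma> i < \<sigma> j \<longleftrightarrow> \<tau> i < \<tau> j" if "i \<in> {1..n}" "j \<in> {1..n}" for i j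
      unfolding ranking_of_block_colouring[OF \<pi> \<sigma>(1,3) that]
        ranking_of_block_colouring[OF \<pi> \<tau>(1,3) that] by (simp only: that)
    then show "\<sigma> = \<tau>" by (rule ranking_unique[OF \<sigma>(1) \<tau>(1)])
  qed
  show "pair_mset_of n K J ` {\<sigma>. \<sigma> permutes {1..n} \<and> Des n \<sigma> \<subseteq> K \<and> Des n (\<pi> \<circ> inv \<sigma>) \<subseteq> J} =
        {M \<in> pair_msets n K J. Des n \<pi> \<subseteq> breaks M}"
  proof (intro equalityI subsetI)
    fix M assume "M \<in> {M \<in> pair_msets n K J. Des n \<pi> \<subseteq> breaks M}"
    then show "M \<in> pair_mset_of n K J ` {\<sigma>. \<sigma> permutes {1..n} \<and> Des n \<sigma> \<subseteq> K \<and> Des n (\<pi> \<circ> inv \<sigma>) \<subseteq> J}"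
      using pair_mset_of_surj[OF \<pi>, of M K J] by blast
  next
    fix M assume "M \<in> pair_mset_of n K J ` {\<sigma>. \<sigma> permutes {1..n} \<and> Des n \<sigma> \<subseteq> K \<and> Des n (\<pi> \<circ> inv \<sigma>) \<subseteq> J}"
    then obtain \<sigma> where "M = pair_mset_of n K J \<sigma>" "\<sigma> permutes {1..n}" "Des n \<sigma> \<subseteq> K"
      "Des n (\<pi> \<circ> inv \<sigma>) \<subseteq> J" by auto
    then show "M \<in> {M \<in> pair_msets n K J. Des n \<pi> \<subseteq> breaks M}"
      using pair_mset_of_in[OF \<pi>] by simp
  qed
qed


section \<open>Compositions as contents of multisets\<close>

definition keys_list :: "'a::linorder multiset \<Rightarrow> 'a list" where
  "keys_list X = sorted_list_of_set (set_mset X)"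

definition content :: "'a::linorder multiset \<Rightarrow> nat list" where
  "content X = map (count X) (keys_list X)"

definition partial_sums :: "nat list \<Rightarrow> nat set" where
  "partial_sums \<alpha> = (\<lambda>k. sum_list (take k \<alpha>)) ` {..length \<alpha>}"

lemma set_keys_list [simp]: "set (keys_list X) = set_mset X"
  and sorted_keys_list: "sorted_wrt (<) (keys_list X)"
  and distinct_keys_list: "distinct (keys_list X)"
  by (simp_all add: keys_list_def)

lemma sum_take_less:
  assumes "0 \<notin> set \<alpha>" "i < j" "j \<le> length (\<alpha> :: nat list)"
  shows "sum_list (take i \<alpha>) < sum_list (take j \<alpha>)"
proof -
  have "take j \<alpha> = take i \<alpha> @ \<alpha> ! i # take (j - Suc i) (drop (Suc i) \<alpha>)"
    using assms(2,3) by (metis Cons_nth_drop_Suc Suc_diff_Suc le_add_diff_inverse less_imp_le_nat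
        order_less_le_trans take_Suc_Cons take_add)
  moreover have "\<alpha> ! i \<noteq> 0" using assms by (metis nth_mem order_less_le_trans)
  ultimately show ?thesis by simp
qed

text \<open>
  The parts are the successive differences of the partial sums, which increase strictly.
\<close>

lemma co_partial_sums:
  assumes "0 \<notin> set \<alpha>" "\<alpha> \<noteq> []" "sum_list \<alpha> = n"
  shows "co n (partial_sums \<alpha> \<inter> {1..n - 1}) = \<alpha>"
proof -
  define P where "P k = sum_list (take k \<alpha>)" for k
  have less: "P i < P j" if "i < j" "j \<le> length \<alpha>" for i j
    unfolding P_def using assms(1) that by (rule sum_take_less)
  have P0: "P 0 = 0" and Pn: "P (length \<alpha>) = n" using assms(3) by (simp_all add: P_def)
  have sums: "partial_sums \<alpha> = P ` {..length \<alpha>}" by (simp add: partial_sums_def P_def[abs_def])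
  have "partial_sums \<alpha> \<inter> {1..n - 1} = P ` {1..<length \<alpha>}" (is "?L = ?R")
  proof (intro equalityI subsetI)
    fix x assume "x \<in> ?L"
    then obtain k where k: "x = P k" "k \<le> length \<alpha>" and "1 \<le> x" "x \<le> n - 1"
      by (auto simp: sums)
    have "k \<noteq> 0" using P0 k(1) \<open>1 \<le> x\<close> by (intro notI) simp
    moreover have "k \<noteq> length \<alpha>" using Pn k \<open>1 \<le> x\<close> \<open>x \<le> n - 1\<close> by (intro notI) simp
    ultimately show "x \<in> ?R" using k by simp
  next
    fix x assume "x \<in> ?R"
    then obtain k where "x = P k" "1 \<le> k" "k < length \<alpha>" by auto
    moreover from this have "0 < P k" "P k < n" using less[of 0 k] less[of k "length \<alpha>"] P0 Pn by simp_all
    ultimately show "x \<in> ?L" by (simp add: sums)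
  qed
  also have "\<dots> = set (map P [1..<length \<alpha>])" by simp
  finally have "sorted_list_of_set (partial_sums \<alpha> \<inter> {1..n - 1}) =
      sorted_list_of_set (set (map P [1..<length \<alpha>]))" by simp
  also have "\<dots> = map P [1..<length \<alpha>]"
  proof -
    have "sorted_wrt (<) (map P [1..<length \<alpha>])"
      by (simp add: sorted_wrt_iff_nth_less less)
    then show ?thesis
      by (intro sorted_list_of_set.idem_if_sorted_distinct) (simp_all add: strict_sorted_iff)
  qed
  finally have js: "sorted_list_of_set (partial_sums \<alpha> \<inter> {1..n - 1}) = map P [1..<length \<alpha>]" .
  have "map P [1..<length \<alpha>] @ [n] = map P [1..<Suc (length \<alpha>)]"
    using assms(2) Pn by (simp add: Suc_le_eq)
  moreover have "0 # map P [1..<length \<alpha>] = map P [0..<length \<alpha>]"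
    using assms(2) P0 by (simp add: upt_conv_Cons)
  ultimately have "co n (partial_sums \<alpha> \<inter> {1..n - 1}) =
      map2 (-) (map P [1..<Suc (length \<alpha>)]) (map P [0..<length \<alpha>])"
    by (simp only: co_def js Let_def)
  also have "\<dots> = \<alpha>"
    by (rule nth_equalityI) (simp_all add: P_def take_Suc_conv_app_nth del: upt_Suc)
  finally show ?thesis .
qed

lemma sum_list_content: "sum_list (content X) = size X"
  using distinct_keys_list[of X]
  by (simp add: content_def sum_list_distinct_conv_sum_set size_multiset_overloaded_eq)

lemma zero_notin_content: "0 \<notin> set (content X)"
  by (simp add: content_def image_iff)

lemma length_content: "length (content X) = card (set_mset X)"
  using distinct_card[OF distinct_keys_list[of X]] by (simp add: content_def)

lemma size_filter_eq_card:
  "size (filter_mset P X) = card {i \<in> {1..size X}. P (word X i)}"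
proof -
  have "filter_mset P X = filter_mset P (image_mset (word X) (mset_set {1..size X}))"
    by (simp only: image_mset_word)
  then show ?thesis by (simp add: filter_mset_image_mset)
qed

lemma sum_take_content:
  assumes "k < length (content X)"
  shows "sum_list (take k (content X)) = size {#x \<in># X. x < keys_list X ! k#}"
proof -
  let ?ks = "keys_list X"
  have k: "k < length ?ks" using assms by (simp add: content_def)
  have less: "?ks ! i < ?ks ! j \<longleftrightarrow> i < j" if "i < length ?ks" "j < length ?ks" for i j
    using sorted_wrt_nth_less[OF sorted_keys_list[of X]] that
    by (metis linorder_neqE_nat order_less_asym order_less_irrefl)
  have "set (take k ?ks) = {x \<in> set ?ks. x < ?ks ! k}"
  proof (intro equalityI subsetI)
    fix x assume "x \<in> set (take k ?ks)"
    then obtain i where "i < k" "x = ?ks ! i" using k by (auto simp: in_set_conv_nth)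
    then show "x \<in> {x \<in> set ?ks. x < ?ks ! k}" using k less[of i k] by (simp del: set_keys_list)
  next
    fix x assume x: "x \<in> {x \<in> set ?ks. x < ?ks ! k}"
    then obtain i where "i < length ?ks" "x = ?ks ! i" by (auto simp: in_set_conv_nth simp del: set_keys_list)
    then show "x \<in> set (take k ?ks)" using x k less[of i k] by (auto simp: in_set_conv_nth)
  qed
  then have "sum_list (take k (content X)) = (\<Sum>x | x \<in># X \<and> x < ?ks ! k. count X x)"
    using distinct_keys_list[of X]
    by (simp add: content_def take_map sum_list_distinct_conv_sum_set)
  also have "\<dots> = size {#x \<in># X. x < ?ks ! k#}"
    unfolding size_multiset_overloaded_eq by (rule sum.cong) auto
  finally show ?thesis .
qed

text \<open>
  The sorted word jumps to the value \<open>v\<close> after exactly as many positions as there are elements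
  below \<open>v\<close>, which is a partial sum of the multiplicities.
\<close>

lemma breaks_eq_partial_sums: "breaks X = partial_sums (content X) \<inter> {1..size X - 1}"
proof (intro equalityI subsetI)
  fix i assume "i \<in> breaks X"
  then have i: "i \<in> {1..size X - 1}" "word X i \<noteq> word X (i + 1)" by (auto simp: breaks_def)
  have w: "word X r \<le> word X s" if "1 \<le> r" "r \<le> s" "s \<le> size X" for r s
    using mono_onD[OF word_mono[of X]] that by simp
  have "word X (i + 1) \<in> set (keys_list X)" using word_in[of "i + 1" X] i(1) by auto
  then obtain k where k: "k < length (keys_list X)" "keys_list X ! k = word X (i + 1)"
    unfolding in_set_conv_nth by blast
  have "{j \<in> {1..size X}. word X j < word X (i + 1)} = {1..i}"
  proof (intro equalityI subsetI)
    fix j assume "j \<in> {j \<in> {1..size X}. word X j < word X (i + 1)}"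
    then show "j \<in> {1..i}" using w[of "i + 1" j] i(1) by (cases "j \<le> i") auto
  next
    fix j assume "j \<in> {1..i}"
    then have "word X j \<le> word X i" using i(1) by (intro w) auto
    moreover have "word X i < word X (i + 1)"
      using i w[of i "i + 1"] by (auto simp: order_less_le)
    ultimately show "j \<in> {j \<in> {1..size X}. word X j < word X (i + 1)}"
      using \<open>j \<in> {1..i}\<close> i(1) by auto
  qed
  then have "sum_list (take k (content X)) = i"
    using sum_take_content[of k X] k by (simp add: content_def size_filter_eq_card)
  moreover have "k \<le> length (content X)" using k(1) by (simp add: content_def)
  ultimately have "i \<in> partial_sums (content X)" unfolding partial_sums_def by blast
  then show "i \<in> partial_sums (content X) \<inter> {1..size X - 1}" using i(1) by simp
next
  fix i assume i: "i \<in> partial_sums (content X) \<inter> {1..size X - 1}"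
  have w: "word X r \<le> word X s" if "1 \<le> r" "r \<le> s" "s \<le> size X" for r s
    using mono_onD[OF word_mono[of X]] that by simp
  obtain k where k: "k \<le> length (content X)" "sum_list (take k (content X)) = i"
    using i by (auto simp: partial_sums_def)
  have "k \<noteq> length (content X)" using k i by (auto simp: sum_list_content)
  then have k': "k < length (content X)" using k by simp
  define v where "v = keys_list X ! k"
  have card: "card {j \<in> {1..size X}. word X j < v} = i"
    using sum_take_content[OF k'] k(2) by (simp add: size_filter_eq_card v_def)
  have down: "word X r < v" if "1 \<le> r" "r \<le> s" "s \<le> size X" "word X s < v" for r s
    using w[OF that(1-3)] that(4) by simp
  have "word X i < v"
  proof (rule ccontr)
    assume "\<not> word X i < v"
    then have "j < i" if "1 \<le> j" "j \<le> size X" "word X j < v" for j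
      using down[of i j] i that by (cases "i \<le> j") auto
    then have "{j \<in> {1..size X}. word X j < v} \<subseteq> {1..<i}" by auto
    then have "card {j \<in> {1..size X}. word X j < v} \<le> card {1..<i}" by (intro card_mono) auto
    moreover have "1 \<le> i" using i by simp
    ultimately show False using card by simp
  qed
  moreover have "\<not> word X (i + 1) < v"
  proof
    assume "word X (i + 1) < v"
    then have "{1..i + 1} \<subseteq> {j \<in> {1..size X}. word X j < v}" using down[of _ "i + 1"] i by auto
    then have "card {1..i + 1} \<le> card {j \<in> {1..size X}. word X j < v}" by (intro card_mono) auto
    then show False using card by simp
  qed
  ultimately show "i \<in> breaks X" using i by (auto simp: breaks_def)
qed

lemma co_breaks:
  assumes "size X = n" "n \<ge> 1"
  shows "co n (breaks X) = content X"
proof -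
  have "content X \<noteq> []" using sum_list_content[of X] assms by auto
  then show ?thesis
    using co_partial_sums[OF zero_notin_content[of X] _ sum_list_content] assms
    by (simp add: breaks_eq_partial_sums)
qed

lemma co_eq_content: "J \<subseteq> {1..n - 1} \<Longrightarrow> n \<ge> 1 \<Longrightarrow> co n J = content (block_mset n J)"
  using co_breaks[of "block_mset n J" n] by (simp add: breaks_block_mset)

lemma mset_content: "mset (content X) = image_mset (count X) (mset_set (set_mset X))"
  using distinct_keys_list[of X] by (simp add: content_def mset_set_set[symmetric])

lemma count_image_mset_inj_on:
  assumes "inj_on f (set_mset X)" "x \<in># X"
  shows "count (image_mset f X) (f x) = count X x"
proof -
  have "{y. y \<in># X \<and> f x = f y} = {x}" using assms by (auto dest: inj_onD)
  then show ?thesis by (simp add: count_image_mset')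
qed

text \<open>
  Renaming the elements injectively may change their order, but not the multiset of multiplicities.
\<close>

lemma co_sim_breaks_image:
  assumes "inj_on f (set_mset X)" "size X = n" "n \<ge> 1"
  shows "co_sim n (breaks X) (breaks (image_mset f X))"
proof -
  have "mset (content (image_mset f X)) =
      image_mset (count (image_mset f X)) (image_mset f (mset_set (set_mset X)))"
    using assms(1) by (simp add: mset_content image_mset_mset_set)
  also have "\<dots> = mset (content X)"
    unfolding mset_content image_mset.compositionality comp_def
    by (rule image_mset_cong) (simp add: count_image_mset_inj_on[OF assms(1)])
  finally show ?thesis using assms(2,3) by (simp add: co_sim_def co_breaks)
qed

lemma card_breaks:
  assumes "size X = n" "n \<ge> 1"
  shows "card (set_mset X) = Suc (card (breaks X))"
proof -
  have "length (co n (breaks X)) = Suc (card (breaks X))"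
    using finite_subset[OF breaks_subset[of X]] by (simp add: co_def Let_def)
  then show ?thesis using assms by (simp add: co_breaks length_content)
qed

lemma set_block_mset:
  assumes "J \<subseteq> {1..n - 1}" "n \<ge> 1"
  shows "set_mset (block_mset n J) = {..card J}"
proof (rule card_subset_eq)
  have "finite J" by (rule finite_subset[OF assms(1)]) simp
  then show "set_mset (block_mset n J) \<subseteq> {..card J}"
    by (auto simp: block_mset_def block_of_def intro!: card_mono)
  show "card (set_mset (block_mset n J)) = card {..card J}"
    using card_breaks[of "block_mset n J" n] assms by (simp add: breaks_block_mset)
qed simp


section \<open>Descent statistics of multisets of permutations\<close>

definition Des_count :: "nat \<Rightarrow> (nat \<Rightarrow> nat) multiset \<Rightarrow> nat set \<Rightarrow> nat" where
  "Des_count n B D = size {#\<pi> \<in># B. Des n \<pi> \<subseteq> D#}"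

lemma exists_bij_betw_of_image_mset_eq:
  assumes "finite S" "finite T" "image_mset p (mset_set S) = image_mset q (mset_set T)"
  shows "\<exists>\<Psi>. bij_betw \<Psi> S T \<and> (\<forall>s\<in>S. q (\<Psi> s) = p s)"
  using assms
proof (induction S arbitrary: T rule: finite_induct)
  case empty
  then have "T = {}" by (simp add: mset_set_empty_iff)
  then show ?case by (auto simp: bij_betw_def)
next
  case (insert s S)
  have "p s \<in># image_mset q (mset_set T)" by (simp flip: insert.prems(2) add: insert.hyps)
  then obtain t where t: "t \<in> T" "q t = p s" using insert.prems(1) by auto
  have "mset_set T = add_mset t (mset_set (T - {t}))"
    using t insert.prems(1) by (simp add: mset_set.remove)
  then have "image_mset p (mset_set S) = image_mset q (mset_set (T - {t}))"
    using insert.prems(2) insert.hyps t by simp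
  from insert.IH[OF _ this] obtain \<Psi>
    where \<Psi>: "bij_betw \<Psi> S (T - {t})" "\<forall>s\<in>S. q (\<Psi> s) = p s"
    using insert.prems(1) by auto
  have "bij_betw (\<Psi>(s := t)) S (T - {t})"
    using \<Psi>(1) insert.hyps by (subst bij_betw_cong[of S _ \<Psi>]) auto
  then have "bij_betw (\<Psi>(s := t)) (insert s S) (insert t (T - {t}))"
    using bij_betw_combine[of "\<Psi>(s := t)" S "T - {t}" "{s}" "{t}"] by simp
  then have "bij_betw (\<Psi>(s := t)) (insert s S) T" using t by (simp add: insert_absorb)
  moreover have "\<forall>r\<in>insert s S. q ((\<Psi>(s := t)) r) = p r"
    using \<Psi>(2) t insert.hyps by auto
  ultimately show ?case by blast
qed

lemma finite_copies: "finite (copies A)"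
proof -
  have "copies A = (SIGMA x:set_mset A. {..<count A x})"
    by (auto simp: copies_def) (metis count_greater_zero_iff gr_zeroI less_zeroE)
  then show ?thesis by simp
qed

lemma image_mset_fst_copies: "image_mset fst (mset_set (copies A)) = A"
proof (rule multiset_eqI)
  fix x
  have "{c \<in> copies A. x = fst c} = Pair x ` {..<count A x}" by (auto simp: copies_def)
  then have "card {c \<in> copies A. x = fst c} = count A x" by (simp add: card_image inj_on_def)
  then show "count (image_mset fst (mset_set (copies A))) x = count A x"
    using finite_copies[of A] by (simp add: count_image_mset')
qed

text \<open>
  A bijection between labelled copies that turns the statistic \<open>p\<close> into the statistic \<open>q\<close> exists
  exactly if the two statistics are equidistributed.  Both descent-preserving bijections and the
  bijections in the definition of \<open>D\<close>-symmetry have this form.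
\<close>

lemma copies_bijection_iff:
  "(\<exists>\<Psi>. bij_betw \<Psi> (copies A) (copies C) \<and> (\<forall>c\<in>copies A. q (fst (\<Psi> c)) = p (fst c))) \<longleftrightarrow>
     image_mset p A = image_mset q C"
proof
  assume "\<exists>\<Psi>. bij_betw \<Psi> (copies A) (copies C) \<and> (\<forall>c\<in>copies A. q (fst (\<Psi> c)) = p (fst c))"
  then obtain \<Psi> where \<Psi>: "bij_betw \<Psi> (copies A) (copies C)"
    "\<forall>c\<in>copies A. q (fst (\<Psi> c)) = p (fst c)" by blast
  have "image_mset p A = image_mset (\<lambda>c. p (fst c)) (mset_set (copies A))"
    by (subst image_mset_fst_copies[symmetric]) (simp add: image_mset.compositionality comp_def)
  also have "\<dots> = image_mset (\<lambda>c. q (fst (\<Psi> c))) (mset_set (copies A))"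
    using \<Psi>(2) finite_copies[of A] by (intro image_mset_cong) simp
  also have "\<dots> = image_mset (\<lambda>c. q (fst c)) (image_mset \<Psi> (mset_set (copies A)))"
    by (simp add: image_mset.compositionality comp_def)
  also have "image_mset \<Psi> (mset_set (copies A)) = mset_set (copies C)"
    using \<Psi>(1) by (simp add: image_mset_mset_set bij_betw_def)
  also have "image_mset (\<lambda>c. q (fst c)) (mset_set (copies C)) =
      image_mset q (image_mset fst (mset_set (copies C)))"
    by (simp add: image_mset.compositionality comp_def)
  finally show "image_mset p A = image_mset q C" by (simp add: image_mset_fst_copies)
next
  assume eq: "image_mset p A = image_mset q C"
  have "image_mset (\<lambda>c. p (fst c)) (mset_set (copies A)) = image_mset (\<lambda>c. q (fst c)) (mset_set (copies C))"
    using eq arg_cong[OF image_mset_fst_copies[of A], of "image_mset p"]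
      arg_cong[OF image_mset_fst_copies[of C], of "image_mset q"]
    by (simp add: image_mset.compositionality comp_def)
  from exists_bij_betw_of_image_mset_eq[OF finite_copies finite_copies this]
  show "\<exists>\<Psi>. bij_betw \<Psi> (copies A) (copies C) \<and> (\<forall>c\<in>copies A. q (fst (\<Psi> c)) = p (fst c))" .
qed

text \<open>
  Moebius inversion: the number of members equal to \<open>D\<close> is the number of members inside \<open>D\<close> minus
  those equal to a proper subset, so induction on \<open>D\<close> recovers all multiplicities.
\<close>

lemma multiset_of_sets_eq_iff:
  assumes "finite V" "\<And>E. E \<in># \<A> \<Longrightarrow> E \<subseteq> V" "\<And>E. E \<in># \<C> \<Longrightarrow> E \<subseteq> V"
  shows "\<A> = \<C> \<longleftrightarrow> (\<forall>D. D \<subseteq> V \<longrightarrow> size {#E \<in># \<A>. E \<subseteq> D#} = size {#E \<in># \<C>. E \<subseteq> D#})"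
proof
  assume R: "\<forall>D. D \<subseteq> V \<longrightarrow> size {#E \<in># \<A>. E \<subseteq> D#} = size {#E \<in># \<C>. E \<subseteq> D#}"
  have size: "size {#E \<in># \<B>. E \<subseteq> D#} = count \<B> D + (\<Sum>E | E \<subset> D. count \<B> E)"
    if "finite D" for \<B> :: "'a set multiset" and D
  proof -
    have fin: "finite {E. E \<subset> D}" by (rule finite_subset[of _ "Pow D"]) (use that in auto)
    have "size {#E \<in># \<B>. E \<subseteq> D#} = (\<Sum>E \<in> insert D {E. E \<subset> D}. count {#E \<in># \<B>. E \<subseteq> D#} E)"
      unfolding size_multiset_overloaded_eq
      by (rule sum.mono_neutral_left) (use fin in \<open>auto simp: not_in_iff\<close>)
    also have "\<dots> = count \<B> D + (\<Sum>E | E \<subset> D. count \<B> E)"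
      using fin by (subst sum.insert) (auto intro!: sum.cong)
    finally show ?thesis .
  qed
  have "count \<A> D = count \<C> D" if "D \<subseteq> V" for D
    using finite_subset[OF that assms(1)] that
  proof (induction D rule: finite_psubset_induct)
    case (psubset D)
    have "(\<Sum>E | E \<subset> D. count \<A> E) = (\<Sum>E | E \<subset> D. count \<C> E)"
      using psubset.IH psubset.prems by (intro sum.cong) auto
    then show ?case using R psubset size[of D \<A>] size[of D \<C>] by simp
  qed
  moreover have "count \<A> D = count \<C> D" if "\<not> D \<subseteq> V" for D
    using that assms(2,3) by (metis count_inI)
  ultimately show "\<A> = \<C>" by (metis multiset_eqI)
qed simp

lemma Des_subset: "Des n \<pi> \<subseteq> {1..n - 1}"
  by (auto simp: Des_def)

lemma Des_equiv_iff:
  "Des_equiv n A C \<longleftrightarrow> (\<forall>D. D \<subseteq> {1..n - 1} \<longrightarrow> Des_count n A D = Des_count n C D)"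
proof -
  have "Des_equiv n A C \<longleftrightarrow> image_mset (Des n) A = image_mset (Des n) C"
    unfolding Des_equiv_def by (rule copies_bijection_iff)
  also have "\<dots> \<longleftrightarrow> (\<forall>D. D \<subseteq> {1..n - 1} \<longrightarrow> size {#E \<in># image_mset (Des n) A. E \<subseteq> D#} =
      size {#E \<in># image_mset (Des n) C. E \<subseteq> D#})"
    by (rule multiset_of_sets_eq_iff) (auto simp: Des_def)
  finally show ?thesis by (simp add: Des_count_def filter_mset_image_mset)
qed

text \<open>
  The common form of all five conditions.
\<close>

definition Des_count_symmetric :: "nat \<Rightarrow> (nat \<Rightarrow> nat) multiset \<Rightarrow> bool" where
  "Des_count_symmetric n B \<longleftrightarrow>
     (\<forall>J K. J \<subseteq> {1..n - 1} \<and> K \<subseteq> {1..n - 1} \<and> co_sim n J K \<longrightarrow> Des_count n B J = Des_count n B K)"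

lemma co_sim_card:
  assumes "co_sim n J K" "J \<subseteq> {1..n - 1}" "K \<subseteq> {1..n - 1}"
  shows "card J = card K"
proof -
  have "length (co n L) = Suc (card L)" if "L \<subseteq> {1..n - 1}" for L
    using finite_subset[OF that] by (simp add: co_def Let_def)
  then show ?thesis using assms mset_eq_length[OF assms(1)[unfolded co_sim_def]] by simp
qed

text \<open>
  Blocks of equal length are matched up.  Since both sets have the same number of blocks, the
  matching permutes the block numbers and extends by the identity to a bijection of all naturals,
  which is needed when it acts on the variables of a power series.
\<close>

lemma co_sim_renaming:
  assumes "co_sim n J K" "J \<subseteq> {1..n - 1}" "K \<subseteq> {1..n - 1}" "n \<ge> 1"
  obtains \<phi> where "bij \<phi>" "block_mset n K = image_mset \<phi> (block_mset n J)"
proof -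
  let ?X = "block_mset n J" and ?Y = "block_mset n K"
  have "card J = card K" using assms(1-3) by (rule co_sim_card)
  then have set_eq: "set_mset ?Y = set_mset ?X" using assms by (simp add: set_block_mset)
  have "image_mset (count ?X) (mset_set (set_mset ?X)) = image_mset (count ?Y) (mset_set (set_mset ?Y))"
    using assms by (simp add: co_sim_def co_eq_content mset_content)
  from exists_bij_betw_of_image_mset_eq[OF _ _ this]
  obtain \<psi> where "bij_betw \<psi> (set_mset ?X) (set_mset ?Y)"
    and \<psi>2: "\<forall>x\<in>set_mset ?X. count ?Y (\<psi> x) = count ?X x" by blast
  then have \<psi>: "bij_betw \<psi> (set_mset ?X) (set_mset ?X)" by (simp only: set_eq)
  define \<phi> where "\<phi> x = (if x \<in># ?X then \<psi> x else x)" for x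
  have "bij_betw \<phi> (set_mset ?X) (set_mset ?X)"
    using \<psi> by (subst bij_betw_cong[of _ _ \<psi>]) (auto simp: \<phi>_def)
  then have "\<phi> permutes set_mset ?X" by (rule bij_imp_permutes) (auto simp: \<phi>_def)
  then have bij: "bij \<phi>" by (rule permutes_bij)
  have inj: "inj_on \<phi> (set_mset ?X)" using bij_is_inj[OF bij] by (rule inj_on_subset) simp
  have "count ?Y y = count (image_mset \<phi> ?X) y" for y
  proof (cases "y \<in># ?X")
    case True
    then obtain x where x: "x \<in># ?X" "y = \<phi> x"
      using \<open>\<phi> permutes set_mset ?X\<close> by (metis permutes_image imageE)
    then show ?thesis
      using bspec[OF \<psi>2 x(1)] count_image_mset_inj_on[OF inj x(1)] by (simp add: \<phi>_def)
  next
    case False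
    then have "y \<notin># image_mset \<phi> ?X"
      using \<open>\<phi> permutes set_mset ?X\<close> by (metis permutes_image set_image_mset)
    then show ?thesis using False set_eq by (metis count_inI)
  qed
  then show ?thesis using bij that multiset_eqI by metis
qed

lemma Des_count_breaks_image:
  assumes "Des_count_symmetric n B" "inj_on f (set_mset X)" "size X = n" "n \<ge> 1"
  shows "Des_count n B (breaks (image_mset f X)) = Des_count n B (breaks X)"
proof -
  have "co_sim n (breaks X) (breaks (image_mset f X))"
    using assms(2-4) by (rule co_sim_breaks_image)
  moreover have "breaks X \<subseteq> {1..n - 1}" "breaks (image_mset f X) \<subseteq> {1..n - 1}"
    using breaks_subset[of X] breaks_subset[of "image_mset f X"] assms(3) by simp_all
  ultimately show ?thesis using assms(1) unfolding Des_count_symmetric_def by metis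
qed


section \<open>Products with inverse classes\<close>

definition factor_count :: "nat \<Rightarrow> (nat \<Rightarrow> nat) \<Rightarrow> nat set \<Rightarrow> nat set \<Rightarrow> nat" where
  "factor_count n \<pi> K J =
     card {\<sigma>. \<sigma> permutes {1..n} \<and> Des n \<sigma> \<subseteq> K \<and> Des n (\<pi> \<circ> inv \<sigma>) \<subseteq> J}"

lemma size_filter_mset_eq_sum: "size (filter_mset P A) = (\<Sum>x\<in>#A. of_bool (P x))"
  by (induction A) auto

lemma Des_count_mset_mult:
  "Des_count n (mset_mult A B) D = (\<Sum>\<rho>\<in>#A. \<Sum>\<tau>\<in>#B. of_bool (Des n (\<rho> \<circ> \<tau>) \<subseteq> D))"
  by (induction A)
    (simp_all add: Des_count_def mset_mult_def size_filter_mset_eq_sum image_mset.compositionality comp_def)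

lemma sum_mset_mset_set_of_bool:
  "finite S \<Longrightarrow> (\<Sum>x\<in>#mset_set S. of_bool (P x)) = card {x \<in> S. P x}"
  by (simp flip: size_filter_mset_eq_sum)

lemma inv_comp_inv_permutes:
  assumes "\<sigma> permutes {1..n}" "\<pi> permutes {1..n}"
  shows "inv (\<sigma> \<circ> inv \<pi>) = \<pi> \<circ> inv \<sigma>"
  using assms by (simp add: o_inv_distrib permutes_bij permutes_inv permutes_inv_inv bij_imp_bij_inv)

text \<open>
  The product \<open>\<sigma> = \<rho> \<circ> \<pi>\<close> determines \<open>\<rho>\<close>, and \<open>\<rho>\<close> is the inverse of \<open>\<pi> \<circ> inv \<sigma>\<close>.
\<close>

lemma Des_count_left_mult:
  assumes B: "\<And>\<pi>. \<pi> \<in># B \<Longrightarrow> \<pi> permutes {1..n}"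
  shows "Des_count n (mset_mult (inverse_J_class n J) B) K = (\<Sum>\<pi>\<in>#B. factor_count n \<pi> K J)"
proof -
  let ?R = "{inv \<tau> | \<tau>. \<tau> permutes {1..n} \<and> Des n \<tau> \<subseteq> J}"
  have "Des_count n (mset_mult (inverse_J_class n J) B) K =
      (\<Sum>\<pi>\<in>#B. \<Sum>\<rho>\<in>#mset_set ?R. of_bool (Des n (\<rho> \<circ> \<pi>) \<subseteq> K))"
    unfolding Des_count_mset_mult inverse_J_class_def by (rule sum_mset.swap)
  also have "\<dots> = (\<Sum>\<pi>\<in>#B. card {\<rho> \<in> ?R. Des n (\<rho> \<circ> \<pi>) \<subseteq> K})"
    by (simp only: sum_mset_mset_set_of_bool[OF finite_inverse_J_class])
  also have "\<dots> = (\<Sum>\<pi>\<in>#B. factor_count n \<pi> K J)"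
  proof (intro arg_cong[of _ _ sum_mset] image_mset_cong)
    fix \<pi> assume "\<pi> \<in># B"
    then have \<pi>: "\<pi> permutes {1..n}" by (rule B)
    note inv\<pi> = permutes_inv_o[OF \<pi>]
    show "card {\<rho> \<in> ?R. Des n (\<rho> \<circ> \<pi>) \<subseteq> K} = factor_count n \<pi> K J"
      unfolding factor_count_def
    proof (rule bij_betw_same_card[of "\<lambda>\<rho>. \<rho> \<circ> \<pi>"],
        rule bij_betw_byWitness[of _ "\<lambda>\<sigma>. \<sigma> \<circ> inv \<pi>"])
      show "\<forall>\<rho>\<in>{\<rho> \<in> ?R. Des n (\<rho> \<circ> \<pi>) \<subseteq> K}. (\<rho> \<circ> \<pi>) \<circ> inv \<pi> = \<rho>"
        by (simp add: comp_assoc inv\<pi>)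
      show "\<forall>\<sigma>\<in>{\<sigma>. \<sigma> permutes {1..n} \<and> Des n \<sigma> \<subseteq> K \<and> Des n (\<pi> \<circ> inv \<sigma>) \<subseteq> J}.
          (\<sigma> \<circ> inv \<pi>) \<circ> \<pi> = \<sigma>"
        by (simp add: comp_assoc inv\<pi>)
      show "(\<lambda>\<rho>. \<rho> \<circ> \<pi>) ` {\<rho> \<in> ?R. Des n (\<rho> \<circ> \<pi>) \<subseteq> K} \<subseteq>
          {\<sigma>. \<sigma> permutes {1..n} \<and> Des n \<sigma> \<subseteq> K \<and> Des n (\<pi> \<circ> inv \<sigma>) \<subseteq> J}"
      proof (rule image_subsetI)
        fix \<rho> assume "\<rho> \<in> {\<rho> \<in> ?R. Des n (\<rho> \<circ> \<pi>) \<subseteq> K}"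
        then obtain \<tau> where \<rho>: "\<rho> = inv \<tau>" and
          \<tau>: "\<tau> permutes {1..n}" "Des n \<tau> \<subseteq> J" "Des n (inv \<tau> \<circ> \<pi>) \<subseteq> K" by blast
        have s: "inv \<tau> \<circ> \<pi> permutes {1..n}" by (intro permutes_compose \<pi> permutes_inv \<tau>(1))
        have "\<pi> \<circ> inv (inv \<tau> \<circ> \<pi>) = inv ((inv \<tau> \<circ> \<pi>) \<circ> inv \<pi>)"
          using inv_comp_inv_permutes[OF s \<pi>] by simp
        also have "\<dots> = \<tau>" by (simp add: comp_assoc inv\<pi> permutes_inv_inv[OF \<tau>(1)])
        finally show "\<rho> \<circ> \<pi> \<in> {\<sigma>. \<sigma> permutes {1..n} \<and> Des n \<sigma> \<subseteq> K \<and> Des n (\<pi> \<circ> inv \<sigma>) \<subseteq> J}"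
          using s \<tau> \<rho> by simp
      qed
      show "(\<lambda>\<sigma>. \<sigma> \<circ> inv \<pi>) ` {\<sigma>. \<sigma> permutes {1..n} \<and> Des n \<sigma> \<subseteq> K \<and> Des n (\<pi> \<circ> inv \<sigma>) \<subseteq> J} \<subseteq>
          {\<rho> \<in> ?R. Des n (\<rho> \<circ> \<pi>) \<subseteq> K}"
      proof (rule image_subsetI)
        fix \<sigma> assume "\<sigma> \<in> {\<sigma>. \<sigma> permutes {1..n} \<and> Des n \<sigma> \<subseteq> K \<and> Des n (\<pi> \<circ> inv \<sigma>) \<subseteq> J}"
        then have \<sigma>: "\<sigma> permutes {1..n}" "Des n \<sigma> \<subseteq> K" "Des n (\<pi> \<circ> inv \<sigma>) \<subseteq> J" by auto
        have s: "\<sigma> \<circ> inv \<pi> permutes {1..n}" by (intro permutes_compose \<sigma>(1) permutes_inv \<pi>)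
        have "\<sigma> \<circ> inv \<pi> = inv (\<pi> \<circ> inv \<sigma>)"
          using inv_comp_inv_permutes[OF \<sigma>(1) \<pi>] permutes_inv_inv[OF s] by metis
        moreover have "\<pi> \<circ> inv \<sigma> permutes {1..n}" by (intro permutes_compose \<pi> permutes_inv \<sigma>(1))
        ultimately have "\<sigma> \<circ> inv \<pi> \<in> ?R" using \<sigma>(3) by blast
        then show "\<sigma> \<circ> inv \<pi> \<in> {\<rho> \<in> ?R. Des n (\<rho> \<circ> \<pi>) \<subseteq> K}"
          using \<sigma>(2) by (simp add: comp_assoc inv\<pi>)
      qed
    qed
  qed
  finally show ?thesis .
qed

text \<open>
  For \<open>\<rho> = inv \<tau>\<close> the two conditions on \<open>\<tau>\<close> are those on the left with \<open>J\<close> and \<open>K\<close> exchanged, so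
  multiplication on either side is counted by the same matrices up to transposition.
\<close>

lemma Des_count_right_mult:
  "Des_count n (mset_mult B (inverse_J_class n J)) K = (\<Sum>\<pi>\<in>#B. factor_count n \<pi> J K)"
proof -
  let ?R = "{inv \<tau> | \<tau>. \<tau> permutes {1..n} \<and> Des n \<tau> \<subseteq> J}"
  have "Des_count n (mset_mult B (inverse_J_class n J)) K =
      (\<Sum>\<pi>\<in>#B. card {\<rho> \<in> ?R. Des n (\<pi> \<circ> \<rho>) \<subseteq> K})"
    unfolding Des_count_mset_mult inverse_J_class_def
    by (simp only: sum_mset_mset_set_of_bool[OF finite_inverse_J_class])
  also have "\<dots> = (\<Sum>\<pi>\<in>#B. factor_count n \<pi> J K)"
  proof (intro arg_cong[of _ _ sum_mset] image_mset_cong)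
    fix \<pi>
    show "card {\<rho> \<in> ?R. Des n (\<pi> \<circ> \<rho>) \<subseteq> K} = factor_count n \<pi> J K"
      unfolding factor_count_def
      by (rule bij_betw_same_card[of inv], rule bij_betw_byWitness[of _ inv])
        (auto simp: permutes_inv permutes_inv_inv)
  qed
  finally show ?thesis .
qed

lemma size_pair_mset:
  assumes "M \<in> pair_msets n K J"
  shows "size M = n"
proof -
  have "size (image_mset fst M) = size (block_mset n K)" using assms by (simp only: pair_msets_def mem_Collect_eq)
  then show ?thesis by simp
qed

lemma finite_pair_msets: "finite (pair_msets n K J)"
proof -
  let ?A = "set_mset (block_mset n K) \<times> set_mset (block_mset n J)"
  have "pair_msets n K J \<subseteq> mset ` {xs. set xs \<subseteq> ?A \<and> length xs = n}"
  proof
    fix M assume M: "M \<in> pair_msets n K J"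
    obtain xs where xs: "mset xs = M" using ex_mset by blast
    have "set_mset M \<subseteq> ?A"
    proof
      fix x assume "x \<in># M"
      then have "fst x \<in># image_mset fst M" "snd x \<in># image_mset snd M" by simp_all
      then have "fst x \<in># block_mset n K" "snd x \<in># block_mset n J"
        using M by (simp_all only: pair_msets_def mem_Collect_eq)
      then show "x \<in> ?A" by (simp add: mem_Times_iff)
    qed
    then have "xs \<in> {xs. set xs \<subseteq> ?A \<and> length xs = n}"
      using xs size_pair_mset[OF M] by (metis (mono_tags, lifting) mem_Collect_eq set_mset_mset size_mset)
    then show "M \<in> mset ` {xs. set xs \<subseteq> ?A \<and> length xs = n}" using xs by blast
  qed
  then show ?thesis by (rule finite_subset) (intro finite_imageI finite_lists_length_eq, simp)
qed

lemma sum_factor_count: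
  assumes B: "\<And>\<pi>. \<pi> \<in># B \<Longrightarrow> \<pi> permutes {1..n}"
  shows "(\<Sum>\<pi>\<in>#B. factor_count n \<pi> K J) = (\<Sum>M\<in>pair_msets n K J. Des_count n B (breaks M))"
proof -
  have "(\<Sum>\<pi>\<in>#B. factor_count n \<pi> K J) =
      (\<Sum>\<pi>\<in>#B. \<Sum>M\<in>#mset_set (pair_msets n K J). of_bool (Des n \<pi> \<subseteq> breaks M))"
    by (intro arg_cong[of _ _ sum_mset] image_mset_cong)
      (simp only: factor_count_def card_eq_card_pair_msets[OF B]
        sum_mset_mset_set_of_bool[OF finite_pair_msets])
  also have "\<dots> = (\<Sum>M\<in>#mset_set (pair_msets n K J). \<Sum>\<pi>\<in>#B. of_bool (Des n \<pi> \<subseteq> breaks M))"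
    by (rule sum_mset.swap)
  finally show ?thesis
    by (simp add: sum_unfold_sum_mset Des_count_def size_filter_mset_eq_sum)
qed

text \<open>
  Makes the products with an empty descent set explicit: it is what turns the conditions on products
  back into statements about \<open>B\<close> itself.
\<close>

lemma Des_empty_imp_id:
  assumes "\<sigma> permutes {1..n}" "Des n \<sigma> \<subseteq> {}"
  shows "\<sigma> = id"
proof (rule ranking_unique[OF assms(1) permutes_id])
  have *: "\<sigma> i < \<sigma> j" if "i \<in> {1..n}" "j \<in> {1..n}" "i < j" for i j
    using that by (intro strict_mono_off_breaks[OF assms(2,1)]) (auto simp: block_of_def)
  fix i j assume "i \<in> {1..n}" "j \<in> {1..n}"
  then show "\<sigma> i < \<sigma> j \<longleftrightarrow> id i < id j"
    using *[of i j] *[of j i] by (cases i j rule: linorder_cases) auto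
qed

lemma factor_count_empty:
  assumes "\<pi> permutes {1..n}"
  shows "factor_count n \<pi> {} J = of_bool (Des n \<pi> \<subseteq> J)"
    and "factor_count n \<pi> J {} = of_bool (Des n \<pi> \<subseteq> J)"
proof -
  have "Des n id = {}" by (auto simp: Des_def)
  then have "{\<sigma>. \<sigma> permutes {1..n} \<and> Des n \<sigma> \<subseteq> {} \<and> Des n (\<pi> \<circ> inv \<sigma>) \<subseteq> J} =
      (if Des n \<pi> \<subseteq> J then {id} else {})"
  proof (intro equalityI subsetI)
    fix \<sigma> assume \<sigma>: "\<sigma> \<in> {\<sigma>. \<sigma> permutes {1..n} \<and> Des n \<sigma> \<subseteq> {} \<and> Des n (\<pi> \<circ> inv \<sigma>) \<subseteq> J}"
    then have "\<sigma> = id" using Des_empty_imp_id by blast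
    then show "\<sigma> \<in> (if Des n \<pi> \<subseteq> J then {id} else {})" using \<sigma> by (simp add: inv_id)
  qed (auto simp: permutes_id split: if_splits)
  then show "factor_count n \<pi> {} J = of_bool (Des n \<pi> \<subseteq> J)" by (simp add: factor_count_def)
  have "\<sigma> = \<pi>" if "\<sigma> permutes {1..n}" "Des n (\<pi> \<circ> inv \<sigma>) \<subseteq> {}" for \<sigma>
  proof -
    have "\<pi> \<circ> inv \<sigma> = id"
      using that assms by (intro Des_empty_imp_id permutes_compose permutes_inv) auto
    then have "(\<pi> \<circ> inv \<sigma>) \<circ> \<sigma> = \<sigma>" by simp
    then show ?thesis by (simp add: comp_assoc permutes_inv_o[OF that(1)])
  qed
  then have "{\<sigma>. \<sigma> permutes {1..n} \<and> Des n \<sigma> \<subseteq> J \<and> Des n (\<pi> \<circ> inv \<sigma>) \<subseteq> {}} =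
      (if Des n \<pi> \<subseteq> J then {\<pi>} else {})"
    using assms \<open>Des n id = {}\<close> by (auto simp: permutes_inv_o[OF assms])
  then show "factor_count n \<pi> J {} = of_bool (Des n \<pi> \<subseteq> J)" by (simp add: factor_count_def)
qed

lemma sum_factor_count_empty:
  assumes B: "\<And>\<pi>. \<pi> \<in># B \<Longrightarrow> \<pi> permutes {1..n}"
  shows "(\<Sum>\<pi>\<in>#B. factor_count n \<pi> {} J) = Des_count n B J"
    and "(\<Sum>\<pi>\<in>#B. factor_count n \<pi> J {}) = Des_count n B J"
  unfolding Des_count_def size_filter_mset_eq_sum
  by (intro arg_cong[of _ _ sum_mset] image_mset_cong; simp only: factor_count_empty[OF B])+

lemma sum_pair_msets_reindex:
  assumes "\<And>x. g (f x) = x" "\<And>x. f (g x) = x"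
    and "\<And>M. M \<in> pair_msets n K J \<Longrightarrow> image_mset f M \<in> pair_msets n K' J'"
    and "\<And>M. M \<in> pair_msets n K' J' \<Longrightarrow> image_mset g M \<in> pair_msets n K J"
  shows "(\<Sum>M\<in>pair_msets n K' J'. h M) = (\<Sum>M\<in>pair_msets n K J. h (image_mset f M))"
  by (rule sum.reindex_bij_witness[of _ "image_mset f" "image_mset g"])
    (use assms in \<open>auto simp: image_mset.compositionality comp_def\<close>)

text \<open>
  A bijection of index pairs permutes the entries of a matrix.  This rearranges the row reading,
  which a symmetric statistic does not see.
\<close>

lemma sum_pair_msets_symmetric:
  assumes B: "Des_count_symmetric n B" and n: "n \<ge> 1"
    and "\<And>x. g (f x) = x" "\<And>x. f (g x) = x"
    and "\<And>M. M \<in> pair_msets n K J \<Longrightarrow> image_mset f M \<in> pair_msets n K' J'"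
    and "\<And>M. M \<in> pair_msets n K' J' \<Longrightarrow> image_mset g M \<in> pair_msets n K J"
  shows "(\<Sum>M\<in>pair_msets n K' J'. Des_count n B (breaks M)) =
         (\<Sum>M\<in>pair_msets n K J. Des_count n B (breaks M))"
proof -
  have "inj f" using assms(3) by (metis injI)
  then have "inj_on f (set_mset M)" for M by (rule inj_on_subset) simp
  then show ?thesis
    using sum_pair_msets_reindex[of g f, OF assms(3-6), of "\<lambda>M. Des_count n B (breaks M)"]
    by (simp add: Des_count_breaks_image[OF B _ size_pair_mset n] cong: sum.cong)
qed

lemma swap_pair_msets: "M \<in> pair_msets n K J \<Longrightarrow> image_mset prod.swap M \<in> pair_msets n J K"
  by (simp add: pair_msets_def image_mset.compositionality comp_def)

lemma map_prod_pair_msets: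
  assumes "M \<in> pair_msets n K J" "block_mset n K' = image_mset f (block_mset n K)"
    "block_mset n J' = image_mset h (block_mset n J)"
  shows "image_mset (map_prod f h) M \<in> pair_msets n K' J'"
proof -
  have "image_mset fst (image_mset (map_prod f h) M) = image_mset f (image_mset fst M)"
    "image_mset snd (image_mset (map_prod f h) M) = image_mset h (image_mset snd M)"
    by (simp_all add: image_mset.compositionality comp_def)
  then show ?thesis using assms by (simp only: pair_msets_def mem_Collect_eq)
qed

text \<open>
  Rearranging the prescribed column sums permutes the columns of the matrices, and likewise for rows.
\<close>

lemma sum_pair_msets_renaming:
  assumes B: "Des_count_symmetric n B" and n: "n \<ge> 1"
    and J: "J \<subseteq> {1..n - 1}" "J' \<subseteq> {1..n - 1}" "co_sim n J J'"
  shows "(\<Sum>M\<in>pair_msets n K J'. Des_count n B (breaks M)) =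
         (\<Sum>M\<in>pair_msets n K J. Des_count n B (breaks M))"
    and "(\<Sum>M\<in>pair_msets n J' K. Des_count n B (breaks M)) =
         (\<Sum>M\<in>pair_msets n J K. Des_count n B (breaks M))"
proof -
  obtain \<phi> where \<phi>: "bij \<phi>" "block_mset n J' = image_mset \<phi> (block_mset n J)"
    using co_sim_renaming[OF J(3,1,2) n] .
  have inv: "inv \<phi> (\<phi> x) = x" "\<phi> (inv \<phi> x) = x" for x
    using \<phi>(1) by (simp_all add: bij_is_inj bij_is_surj surj_f_inv_f)
  have \<phi>': "block_mset n J = image_mset (inv \<phi>) (block_mset n J')"
    by (simp add: \<phi>(2) image_mset.compositionality comp_def inv)
  have K: "block_mset n K = image_mset id (block_mset n K)" by simp
  show "(\<Sum>M\<in>pair_msets n K J'. Des_count n B (breaks M)) =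
      (\<Sum>M\<in>pair_msets n K J. Des_count n B (breaks M))"
    by (rule sum_pair_msets_symmetric[OF B n, of "map_prod id (inv \<phi>)" "map_prod id \<phi>"],
        rule_tac [1-2] prod_eqI)
      (simp_all add: inv map_prod_pair_msets[OF _ K \<phi>(2)] map_prod_pair_msets[OF _ K \<phi>'])
  show "(\<Sum>M\<in>pair_msets n J' K. Des_count n B (breaks M)) =
      (\<Sum>M\<in>pair_msets n J K. Des_count n B (breaks M))"
    by (rule sum_pair_msets_symmetric[OF B n, of "map_prod (inv \<phi>) id" "map_prod \<phi> id"],
        rule_tac [1-2] prod_eqI)
      (simp_all add: inv map_prod_pair_msets[OF _ \<phi>(2) K] map_prod_pair_msets[OF _ \<phi>' K])
qed


section \<open>Commuting with all inverse classes\<close>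

lemma breaks_mono_image:
  assumes "\<And>x y. x \<le> y \<Longrightarrow> f x \<le> f y" "inj_on f (set_mset X)"
  shows "breaks (image_mset f X) = breaks X"
proof -
  have "breaks (image_mset f X) = {i \<in> {1..size X - 1}. f (word X i) \<noteq> f (word X (i + 1))}"
  proof (rule breaks_unique)
    show "mono_on {1..size X} (\<lambda>i. f (word X i))"
      using assms(1) word_mono[of X] by (auto simp: mono_on_def)
    show "image_mset (\<lambda>i. f (word X i)) (mset_set {1..size X}) = image_mset f X"
      using arg_cong[OF image_mset_word[of X], of "image_mset f"]
      by (simp add: image_mset.compositionality comp_def)
  qed
  also have "\<dots> = breaks X"
  proof -
    have "f (word X i) = f (word X (i + 1)) \<longleftrightarrow> word X i = word X (i + 1)"
      if "i \<in> {1..size X - 1}" for i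
      using that word_in[of i X] word_in[of "i + 1" X] by (auto simp: inj_on_eq_iff[OF assms(2)])
    then show ?thesis by (auto simp: breaks_def)
  qed
  finally show ?thesis .
qed

text \<open>
  A matrix has a nonzero entry in each row.  If there are only as many nonzero entries as rows, each
  row has one, and reading the matrix row by row gives the row sums.
\<close>

lemma breaks_pair_mset:
  assumes "M \<in> pair_msets n K J" "K \<subseteq> {1..n - 1}" "n \<ge> 1" "card (set_mset M) = Suc (card K)"
  shows "breaks M = K"
proof -
  have fstM: "image_mset fst M = block_mset n K" using assms(1) by (simp add: pair_msets_def)
  have "card (fst ` set_mset M) = card (set_mset M)"
    using assms(2-4) set_block_mset[of K n] by (simp flip: set_image_mset add: fstM)
  then have inj: "inj_on fst (set_mset M)" by (intro eq_card_imp_inj_on) auto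
  have "breaks M = breaks (image_mset fst M)"
    by (rule breaks_mono_image[symmetric, OF _ inj]) (auto simp: less_eq_prod_def)
  then show ?thesis using assms(2) by (simp add: fstM breaks_block_mset)
qed

text \<open>
  Downward induction on the number of parts.  Let \<open>co n J\<close> and \<open>co n K\<close> be rearrangements of each
  other with \<open>r\<close> parts, and consider the matrices with column sums \<open>co n J\<close> and row sums \<open>co n K\<close>.
  Reading rows and reading columns give rearrangements of the same entries, so if a matrix has more
  than \<open>r\<close> nonzero entries its two terms agree by induction and cancel.  A matrix with exactly \<open>r\<close>
  nonzero entries reads as \<open>co n K\<close> by rows and as \<open>co n J\<close> by columns.  What is left of the equation
  is therefore a multiple of the claim, and the matrix of a rearrangement shows that the multiplier
  is not zero.
\<close>

lemma Des_count_symmetric_if_commutes: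
  assumes comm: "\<And>J K. J \<subseteq> {1..n - 1} \<Longrightarrow> K \<subseteq> {1..n - 1} \<Longrightarrow>
      (\<Sum>M\<in>pair_msets n K J. Des_count n B (breaks M)) =
      (\<Sum>M\<in>pair_msets n J K. Des_count n B (breaks M))"
    and n: "n \<ge> 1"
  shows "Des_count_symmetric n B"
proof -
  have "Des_count n B J = Des_count n B K"
    if "J \<subseteq> {1..n - 1}" "K \<subseteq> {1..n - 1}" "co_sim n J K" for J K
    using that
  proof (induction "n - card J" arbitrary: J K rule: less_induct)
    case less
    note J = less.prems(1) and K = less.prems(2) and sim = less.prems(3)
    let ?P = "pair_msets n K J" and ?g = "Des_count n B"
    obtain \<phi> where \<phi>: "bij \<phi>" "block_mset n K = image_mset \<phi> (block_mset n J)"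
      using co_sim_renaming[OF sim J K n] .
    have card_eq: "card K = card J" using co_sim_card[OF sim J K] by simp
    have fin: "finite ?P" by (rule finite_pair_msets)
    \<comment> \<open>The matrices with the least possible number of nonzero entries.\<close>
    define A where "A = {M \<in> ?P. card (set_mset M) = Suc (card J)}"
    have A: "breaks M = K" "breaks (image_mset prod.swap M) = J" if "M \<in> A" for M
    proof -
      have M: "M \<in> ?P" "card (set_mset M) = Suc (card J)" using that by (auto simp: A_def)
      show "breaks M = K" using breaks_pair_mset[OF M(1) K n] M(2) card_eq by simp
      show "breaks (image_mset prod.swap M) = J"
        using breaks_pair_mset[OF swap_pair_msets[OF M(1)] J n] M(2) by (simp add: card_image)
    qed
    have rest: "?g (breaks (image_mset prod.swap M)) = ?g (breaks M)" if "M \<in> ?P - A" for M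
    proof -
      have M: "M \<in> ?P" "card (set_mset M) \<noteq> Suc (card J)" using that by (auto simp: A_def)
      have size: "size M = n" using M(1) by (rule size_pair_mset)
      have "set_mset (block_mset n J) = snd ` set_mset M"
        using M(1) unfolding pair_msets_def by (metis (mono_tags) mem_Collect_eq set_image_mset)
      then have "card {..card J} \<le> card (set_mset M)"
        unfolding set_block_mset[OF J n] by (simp only: card_image_le[OF finite_set_mset])
      then have "Suc (card J) \<le> card (set_mset M)" by simp
      then have more: "card J < card (breaks M)" using M(2) card_breaks[OF size n] by simp
      have sub: "breaks M \<subseteq> {1..n - 1}" "breaks (image_mset prod.swap M) \<subseteq> {1..n - 1}"
        using breaks_subset[of M] breaks_subset[of "image_mset prod.swap M"] size by simp_all
      have "card (breaks M) < n"
        using card_mono[OF _ sub(1)] n by simp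
      moreover have "co_sim n (breaks M) (breaks (image_mset prod.swap M))"
        using size n by (intro co_sim_breaks_image) simp_all
      ultimately show ?thesis using less.hyps[OF _ sub] more by simp
    qed
    have "(\<Sum>M\<in>A. ?g (breaks M)) + (\<Sum>M\<in>?P - A. ?g (breaks M)) = (\<Sum>M\<in>?P. ?g (breaks M))"
      using sum.subset_diff[of A ?P "\<lambda>M. ?g (breaks M)"] fin by (auto simp: A_def)
    also have "\<dots> = (\<Sum>M\<in>pair_msets n J K. ?g (breaks M))" by (rule comm[OF J K])
    also have "\<dots> = (\<Sum>M\<in>?P. ?g (breaks (image_mset prod.swap M)))"
      by (rule sum_pair_msets_reindex[of prod.swap]) (simp_all add: swap_pair_msets)
    also have "\<dots> = (\<Sum>M\<in>A. ?g (breaks (image_mset prod.swap M))) +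
        (\<Sum>M\<in>?P - A. ?g (breaks (image_mset prod.swap M)))"
      using sum.subset_diff[of A ?P "\<lambda>M. ?g (breaks (image_mset prod.swap M))"] fin
      by (auto simp: A_def)
    finally have "(\<Sum>M\<in>A. ?g (breaks M)) = (\<Sum>M\<in>A. ?g (breaks (image_mset prod.swap M)))"
      using rest by simp
    then have "card A * ?g K = card A * ?g J" using A by simp
    moreover have "image_mset (\<lambda>j. (\<phi> j, j)) (block_mset n J) \<in> A"
    proof -
      have "image_mset (\<lambda>j. (\<phi> j, j)) (block_mset n J) \<in> ?P"
        by (simp add: pair_msets_def image_mset.compositionality comp_def \<phi>(2))
      moreover have "card ((\<lambda>j. (\<phi> j, j)) ` set_mset (block_mset n J)) = Suc (card J)"
        using set_block_mset[OF J n] by (subst card_image) (auto intro: inj_onI)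
      ultimately show ?thesis by (simp add: A_def)
    qed
    moreover have "finite A" using fin by (simp add: A_def)
    ultimately show ?case by auto
  qed
  then show ?thesis by (auto simp: Des_count_symmetric_def)
qed

section \<open>D-symmetry\<close>

lemma is_delta_delta: "ordered_set_partition n U \<Longrightarrow> is_delta n U (delta n U)"
  unfolding delta_def by (rule theI'[OF delta_ex1])

lemma delta_permutes: "ordered_set_partition n U \<Longrightarrow> delta n U permutes {1..n}"
  using is_delta_delta unfolding is_delta_def by blast

lemma block_delta:
  assumes U: "ordered_set_partition n U" and i: "i < length U"
  shows "strict_mono_on (U ! i) (delta n U)"
    and "delta n U ` (U ! i) = {(\<Sum>j<i. card (U ! j))<..(\<Sum>j\<le>i. card (U ! j))}"
    and "U ! i \<subseteq> {1..n}"
proof -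
  show "strict_mono_on (U ! i) (delta n U)"
    "delta n U ` (U ! i) = {(\<Sum>j<i. card (U ! j))<..(\<Sum>j\<le>i. card (U ! j))}"
    using is_delta_delta[OF U] i unfolding is_delta_def by blast+
  have "\<Union>(set U) = {1..n}" using U by (simp add: ordered_set_partition_def partition_on_def)
  then show "U ! i \<subseteq> {1..n}" using nth_mem[OF i] by blast
qed

lemma delta_Suc:
  assumes U: "ordered_set_partition n U" and u: "u \<in> partition_star U"
  shows "delta n U (u + 1) = delta n U u + 1"
proof -
  obtain i where i: "i < length U" "u \<in> U ! i" "u + 1 \<in> U ! i"
    using u by (auto simp: partition_star_def set_star_def in_set_conv_nth)
  have fin: "finite (U ! i)" by (rule finite_subset[OF block_delta(3)[OF U i(1)]]) simp
  have "{v \<in> U ! i. v \<le> u + 1} = insert (u + 1) {v \<in> U ! i. v \<le> u}" using i by auto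
  then have "card {v \<in> U ! i. v \<le> u + 1} = card {v \<in> U ! i. v \<le> u} + 1" using fin by simp
  then show ?thesis
    using strict_mono_on_onto_interval[OF fin block_delta(1,2)[OF U i(1)]] i(2,3) by simp
qed

lemma partition_star_subset:
  assumes U: "ordered_set_partition n U"
  shows "partition_star U \<subseteq> {1..n - 1}"
proof
  fix u assume "u \<in> partition_star U"
  then obtain i where "i < length U" "u \<in> U ! i" "u + 1 \<in> U ! i"
    by (auto simp: partition_star_def set_star_def in_set_conv_nth)
  then have "u \<in> {1..n}" "u + 1 \<in> {1..n}" using block_delta(3)[OF U] by blast+
  then show "u \<in> {1..n - 1}" by auto
qed

lemma delta_star_in:
  assumes U: "ordered_set_partition n U" and u: "u \<in> partition_star U"
  shows "delta n U u \<in> {1..n - 1}"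
proof -
  have "u \<in> {1..n}" "u + 1 \<in> {1..n}" using subsetD[OF partition_star_subset[OF U] u] by auto
  then have "delta n U u \<in> {1..n}" "delta n U (u + 1) \<in> {1..n}"
    by (simp_all only: permutes_in_image[OF delta_permutes[OF U]])
  then show ?thesis using delta_Suc[OF U u] by auto
qed

text \<open>
  The bijection equates the distributions of \<open>Des n \<pi>\<close> and of the preimage of \<open>Des n \<pi>\<close> under
  \<open>delta n U\<close>, both cut down to \<open>partition_star U\<close>.  By Moebius inversion it suffices to compare, for
  each \<open>S\<close>, how often there is no descent in \<open>S\<close> and how often there is none in its image.
\<close>

lemma D_symmetric_iff:
  "D_symmetric n B \<longleftrightarrow> (\<forall>U. ordered_set_partition n U \<longrightarrow> (\<forall>S. S \<subseteq> partition_star U \<longrightarrow>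
      Des_count n B ({1..n - 1} - S) = Des_count n B ({1..n - 1} - delta n U ` S)))"
proof -
  have "(\<exists>\<Psi>. bij_betw \<Psi> (copies B) (copies B) \<and>
             (\<forall>u \<in> partition_star U. \<forall>c \<in> copies B.
                u \<in> Des n (fst c) \<longleftrightarrow> delta n U u \<in> Des n (fst (\<Psi> c)))) \<longleftrightarrow>
        (\<forall>S. S \<subseteq> partition_star U \<longrightarrow>
          Des_count n B ({1..n - 1} - S) = Des_count n B ({1..n - 1} - delta n U ` S))"
    if U: "ordered_set_partition n U" for U
  proof -
    let ?V = "partition_star U" and ?d = "delta n U"
    have fin: "finite ?V" by (rule finite_subset[OF partition_star_subset[OF U]]) simp
    have "(\<exists>\<Psi>. bij_betw \<Psi> (copies B) (copies B) \<and>
             (\<forall>u \<in> ?V. \<forall>c \<in> copies B. u \<in> Des n (fst c) \<longleftrightarrow> ?d u \<in> Des n (fst (\<Psi> c)))) \<longleftrightarrow>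
        (\<exists>\<Psi>. bij_betw \<Psi> (copies B) (copies B) \<and>
             (\<forall>c \<in> copies B. {u \<in> ?V. ?d u \<in> Des n (fst (\<Psi> c))} = {u \<in> ?V. u \<in> Des n (fst c)}))"
    proof -
      have "(\<forall>u \<in> ?V. \<forall>c \<in> copies B. u \<in> Des n (fst c) \<longleftrightarrow> ?d u \<in> Des n (fst (\<Psi> c))) \<longleftrightarrow>
          (\<forall>c \<in> copies B. {u \<in> ?V. ?d u \<in> Des n (fst (\<Psi> c))} = {u \<in> ?V. u \<in> Des n (fst c)})"
        for \<Psi> :: "(nat \<Rightarrow> nat) \<times> nat \<Rightarrow> (nat \<Rightarrow> nat) \<times> nat"
        by blast
      then show ?thesis by (simp only:)
    qed
    also have "\<dots> \<longleftrightarrow>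
        image_mset (\<lambda>\<pi>. {u \<in> ?V. u \<in> Des n \<pi>}) B = image_mset (\<lambda>\<pi>. {u \<in> ?V. ?d u \<in> Des n \<pi>}) B"
      by (rule copies_bijection_iff)
    also have "\<dots> \<longleftrightarrow> (\<forall>S. S \<subseteq> ?V \<longrightarrow>
        size {#\<pi> \<in># B. {u \<in> ?V. u \<in> Des n \<pi>} \<subseteq> S#} = size {#\<pi> \<in># B. {u \<in> ?V. ?d u \<in> Des n \<pi>} \<subseteq> S#})"
      by (subst multiset_of_sets_eq_iff[OF fin]) (auto simp: filter_mset_image_mset)
    also have "\<dots> \<longleftrightarrow> (\<forall>S. S \<subseteq> ?V \<longrightarrow>
        Des_count n B ({1..n - 1} - (?V - S)) = Des_count n B ({1..n - 1} - ?d ` (?V - S)))"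
    proof -
      have "{u \<in> ?V. u \<in> Des n \<pi>} \<subseteq> S \<longleftrightarrow> Des n \<pi> \<subseteq> {1..n - 1} - (?V - S)"
        "{u \<in> ?V. ?d u \<in> Des n \<pi>} \<subseteq> S \<longleftrightarrow> Des n \<pi> \<subseteq> {1..n - 1} - ?d ` (?V - S)"
        if "S \<subseteq> ?V" for S \<pi>
        using Des_subset[of n \<pi>] by blast+
      then show ?thesis by (simp add: Des_count_def)
    qed
    also have "\<dots> \<longleftrightarrow> (\<forall>S. S \<subseteq> ?V \<longrightarrow>
        Des_count n B ({1..n - 1} - S) = Des_count n B ({1..n - 1} - ?d ` S))"
    proof (intro iffI allI impI)
      fix S assume all: "\<forall>S. S \<subseteq> ?V \<longrightarrow> Des_count n B ({1..n - 1} - (?V - S)) =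
          Des_count n B ({1..n - 1} - ?d ` (?V - S))" and "S \<subseteq> ?V"
      then have "?V - (?V - S) = S" by blast
      then show "Des_count n B ({1..n - 1} - S) = Des_count n B ({1..n - 1} - ?d ` S)"
        using all[rule_format, of "?V - S"] by auto
    qed auto
    finally show ?thesis .
  qed
  then show ?thesis unfolding D_symmetric_def by (intro iff_allI imp_cong refl)
qed

text \<open>
  Positions joined by steps in \<open>S\<close> lie in one block of \<open>U\<close>, and there \<open>delta n U\<close> commutes with
  \<open>Suc\<close>.  So it carries the intervals cut out by the complement of \<open>S\<close> to those cut out by the
  complement of the image of \<open>S\<close>.
\<close>

lemma block_of_delta:
  assumes U: "ordered_set_partition n U" and S: "S \<subseteq> partition_star U"
    and uv: "u \<in> {1..n}" "v \<in> {1..n}"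
  defines "J \<equiv> {1..n - 1} - S" and "K \<equiv> {1..n - 1} - delta n U ` S"
  shows "block_of J u = block_of J v \<longleftrightarrow> block_of K (delta n U u) = block_of K (delta n U v)"
proof
  let ?d = "delta n U"
  have step: "?d (w + 1) = ?d w + 1" if "w \<in> S" for w
    using delta_Suc[OF U] S that by blast
  assume eq: "block_of J u = block_of J v"
  show "block_of K (?d u) = block_of K (?d v)"
  proof (rule constant_on_blocks[of n J "\<lambda>w. block_of K (?d w)", OF _ uv eq])
    fix w assume "w \<in> {1..n - 1}" "w \<notin> J"
    then have w: "w \<in> S" by (simp add: J_def)
    then have "?d w \<notin> K" by (simp add: K_def)
    then show "block_of K (?d (w + 1)) = block_of K (?d w)"
      using step[OF w] block_of_Suc[of K "?d w"] by simp
  qed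
next
  let ?d = "delta n U"
  note d = delta_permutes[OF U]
  have step: "?d (w + 1) = ?d w + 1" if "w \<in> S" for w
    using delta_Suc[OF U] S that by blast
  assume eq: "block_of K (?d u) = block_of K (?d v)"
  have "block_of J (inv ?d (?d u)) = block_of J (inv ?d (?d v))"
  proof (rule constant_on_blocks[of n K "\<lambda>x. block_of J (inv ?d x)", OF _ _ _ eq])
    fix x assume "x \<in> {1..n - 1}" "x \<notin> K"
    then obtain w where w: "w \<in> S" "x = ?d w" by (auto simp: K_def)
    then have "inv ?d (x + 1) = w + 1" using step[OF w(1)] permutes_inverses(2)[OF d, of "w + 1"] by simp
    moreover have "inv ?d x = w" using w permutes_inverses(2)[OF d] by simp
    moreover have "w \<notin> J" using w by (simp add: J_def)
    ultimately show "block_of J (inv ?d (x + 1)) = block_of J (inv ?d x)"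
      using block_of_Suc[of J w] by simp
  next
    show "?d u \<in> {1..n}" "?d v \<in> {1..n}" using uv by (simp_all only: permutes_in_image[OF d])
  qed
  then show "block_of J u = block_of J v" by (simp add: permutes_inverses[OF d])
qed

text \<open>
  Since \<open>delta n U\<close> matches the intervals of the two sets, their numberings differ by an injective
  renaming of the block numbers.
\<close>

lemma co_sim_delta:
  assumes U: "ordered_set_partition n U" and S: "S \<subseteq> partition_star U" and n: "n \<ge> 1"
  shows "co_sim n ({1..n - 1} - S) ({1..n - 1} - delta n U ` S)"
proof -
  let ?d = "delta n U"
  define J where "J = {1..n - 1} - S"
  define K where "K = {1..n - 1} - ?d ` S"
  have kernel: "block_of J u = block_of J v \<longleftrightarrow> block_of K (?d u) = block_of K (?d v)"
    if "u \<in> {1..n}" "v \<in> {1..n}" for u v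
    unfolding J_def K_def using block_of_delta[OF U S that] .
  \<comment> \<open>The renaming is read off any position of the block.\<close>
  define \<phi> where "\<phi> b = block_of K (?d (SOME u. u \<in> {1..n} \<and> block_of J u = b))" for b
  have \<phi>: "\<phi> (block_of J u) = block_of K (?d u)" if u: "u \<in> {1..n}" for u
  proof -
    have "(SOME v. v \<in> {1..n} \<and> block_of J v = block_of J u) \<in> {1..n} \<and>
        block_of J (SOME v. v \<in> {1..n} \<and> block_of J v = block_of J u) = block_of J u"
      by (rule someI[of _ u]) (use u in simp)
    then show ?thesis unfolding \<phi>_def using kernel u by blast
  qed
  have "inj_on \<phi> (set_mset (block_mset n J))"
    using \<phi> kernel by (auto simp: block_mset_def intro!: inj_onI)
  moreover have "image_mset \<phi> (block_mset n J) = block_mset n K"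
  proof -
    have "image_mset \<phi> (block_mset n J) = image_mset (\<lambda>u. block_of K (?d u)) (mset_set {1..n})"
      unfolding block_mset_def image_mset.compositionality comp_def
      using \<phi> by (intro image_mset_cong) simp
    also have "\<dots> = block_mset n K"
      unfolding block_mset_def by (rule image_mset_comp_permutes[OF delta_permutes[OF U]])
    finally show ?thesis .
  qed
  ultimately have "co_sim n (breaks (block_mset n J)) (breaks (block_mset n K))"
    using co_sim_breaks_image[of \<phi> "block_mset n J" n] n by simp
  then show ?thesis by (simp add: breaks_block_mset J_def K_def)
qed

text \<open>
  Arrange the blocks of \<open>J\<close> in the order in which blocks of the same lengths occur in \<open>K\<close>.  Then
  \<open>delta n U\<close> shifts each block of \<open>J\<close> onto the corresponding block of \<open>K\<close>.
\<close>

lemma co_sim_imp_delta: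
  assumes J: "J \<subseteq> {1..n - 1}" and K: "K \<subseteq> {1..n - 1}" and sim: "co_sim n J K" and n: "n \<ge> 1"
  obtains U where "ordered_set_partition n U" "partition_star U = {1..n - 1} - J"
    "{1..n - 1} - delta n U ` ({1..n - 1} - J) = K"
proof -
  obtain \<phi> where \<phi>: "bij \<phi>" "block_mset n K = image_mset \<phi> (block_mset n J)"
    using co_sim_renaming[OF sim J K n] .
  have \<phi>_eq: "\<phi> x = \<phi> y \<longleftrightarrow> x = y" for x y using bij_is_inj[OF \<phi>(1)] by (simp add: inj_eq)
  define b where "b x = \<phi> (block_of J x)" for x
  define r where "r = Suc (card K)"
  define U where "U = map (\<lambda>i. {x \<in> {1..n}. b x = i}) [0..<r]"
  have bK: "image_mset b (mset_set {1..n}) = block_mset n K"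
    by (subst \<phi>(2)) (simp add: block_mset_def b_def[abs_def] image_mset.compositionality comp_def)
  have b_image: "b ` {1..n} = {..<r}"
    using arg_cong[OF bK, of set_mset]
    unfolding set_image_mset finite_set_mset_mset_set[OF finite_atLeastAtMost] set_block_mset[OF K n]
    by (simp only: r_def lessThan_Suc_atMost)
  have U_nth: "U ! i = {x \<in> {1..n}. b x = i}" if "i < r" for i using that by (simp add: U_def)
  have len: "length U = r" by (simp add: U_def)
  have "ordered_set_partition n U"
    unfolding ordered_set_partition_def
  proof
    have ne: "{x \<in> {1..n}. b x = i} \<noteq> {}" if "i < r" for i
    proof -
      have "i \<in> b ` {1..n}" unfolding b_image using that by simp
      then show ?thesis by blast
    qed
    have "inj_on (\<lambda>i. {x \<in> {1..n}. b x = i}) {0..<r}"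
    proof (rule inj_onI)
      fix i j assume "i \<in> {0..<r}" and "{x \<in> {1..n}. b x = i} = {x \<in> {1..n}. b x = j}"
      moreover obtain x where "x \<in> {x \<in> {1..n}. b x = i}" using ne[of i] \<open>i \<in> {0..<r}\<close> by fastforce
      ultimately have "x \<in> {x \<in> {1..n}. b x = j}" by blast
      then show "i = j" using \<open>x \<in> {x \<in> {1..n}. b x = i}\<close> by simp
    qed
    then show "distinct U" by (simp add: U_def distinct_map)
    show "partition_on {1..n} (set U)"
    proof (rule partition_onI)
      have "b x < r" if "x \<in> {1..n}" for x
        using imageI[of x "{1..n}" b, OF that] unfolding b_image by simp
      then show "\<Union>(set U) = {1..n}" by (auto simp: U_def)
      show "{} \<notin> set U"
      proof
        assume "{} \<in> set U"
        then obtain i where "i < r" "U ! i = {}" unfolding in_set_conv_nth len by blast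
        then show False using ne U_nth by metis
      qed
      fix p q assume "p \<in> set U" "q \<in> set U" "p \<noteq> q"
      then show "disjnt p q" by (auto simp: U_def disjnt_def)
    qed
  qed
  note U = this
  let ?d = "delta n U"
  note d = delta_permutes[OF U]
  have star: "partition_star U = {1..n - 1} - J"
  proof (intro equalityI subsetI)
    fix u assume u: "u \<in> partition_star U"
    then have "b u = b (u + 1)" by (auto simp: partition_star_def set_star_def U_def)
    then have "u \<notin> J" by (auto simp: b_def \<phi>_eq block_of_Suc[simplified])
    then show "u \<in> {1..n - 1} - J" using partition_star_subset[OF U] u by blast
  next
    fix u assume u: "u \<in> {1..n - 1} - J"
    then have "b (u + 1) = b u" "u \<in> {1..n}" "u + 1 \<in> {1..n}"
      by (auto simp: b_def block_of_Suc[simplified])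
    moreover have "b u < r" using b_image \<open>u \<in> {1..n}\<close> by blast
    ultimately show "u \<in> partition_star U"
      by (auto simp: partition_star_def set_star_def U_def)
  qed
  have inv_in: "inv ?d x \<in> {1..n}" if "x \<in> {1..n}" for x
    using that by (simp only: permutes_in_image[OF permutes_inv[OF d]])
  \<comment> \<open>The blocks of \<open>U\<close> occupy consecutive intervals, so their numbers increase with the position.\<close>
  have bd: "b (inv ?d x) = block_of K x" if x: "x \<in> {1..n}" for x
  proof -
    have "mono_on {1..n} (\<lambda>x. b (inv ?d x))"
    proof (rule mono_onI, rule ccontr)
      fix x y assume xy: "x \<in> {1..n}" "y \<in> {1..n}" "x \<le> y" "\<not> b (inv ?d x) \<le> b (inv ?d y)"
      have bounds: "z \<in> {(\<Sum>j<b (inv ?d z). card (U ! j))<..(\<Sum>j\<le>b (inv ?d z). card (U ! j))}"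
        if "z \<in> {1..n}" for z
      proof -
        have lt: "b (inv ?d z) < r" using b_image inv_in[OF that] by blast
        then have "inv ?d z \<in> U ! b (inv ?d z)" using inv_in[OF that] by (simp add: U_nth)
        then have "?d (inv ?d z) \<in> ?d ` (U ! b (inv ?d z))" by blast
        then show ?thesis using block_delta(2)[OF U] lt len by (simp add: permutes_inverses[OF d])
      qed
      have "(\<Sum>j\<le>b (inv ?d y). card (U ! j)) \<le> (\<Sum>j<b (inv ?d x). card (U ! j))"
        using xy(4) by (intro sum_mono2) auto
      then show False using bounds[OF xy(1)] bounds[OF xy(2)] xy(3) by simp
    qed
    moreover have "image_mset (\<lambda>x. b (inv ?d x)) (mset_set {1..n}) = block_mset n K"
      by (subst image_mset_comp_permutes[OF permutes_inv[OF d]]) (rule bK)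
    ultimately show ?thesis using word_unique word_block_mset x by metis
  qed
  have "?d ` ({1..n - 1} - J) = {1..n - 1} - K"
  proof (rule card_subset_eq)
    show "?d ` ({1..n - 1} - J) \<subseteq> {1..n - 1} - K"
    proof clarify
      fix u assume "u \<in> {1..n - 1}" "u \<notin> J"
      then have u: "u \<in> partition_star U" "u \<in> {1..n}" "u + 1 \<in> {1..n}" using star by auto
      have "block_of K (?d u) = b u" if "u \<in> {1..n}" for u
        using bd[of "?d u"] that permutes_in_image[OF d] by (metis permutes_inverses(2)[OF d])
      then have "block_of K (?d u) = b u" "block_of K (?d u + 1) = b (u + 1)"
        using u(2,3) delta_Suc[OF U u(1)] by metis+
      moreover have "b (u + 1) = b u" using \<open>u \<notin> J\<close> by (simp add: b_def block_of_Suc[simplified])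
      ultimately have "?d u \<notin> K" using block_of_Suc[of K "?d u"] by (auto split: if_splits)
      then show "?d u \<in> {1..n - 1} - K" using delta_star_in[OF U u(1)] by blast
    qed
    have "card J = card K" using sim J K by (rule co_sim_card)
    then show "card (?d ` ({1..n - 1} - J)) = card ({1..n - 1} - K)"
      using J K by (simp add: card_image[OF inj_on_subset[OF permutes_inj[OF d] subset_UNIV]]
        card_Diff_subset finite_subset)
  qed simp
  then have "{1..n - 1} - ?d ` ({1..n - 1} - J) = K" using K by (simp add: double_diff)
  with U star show ?thesis by (rule that)
qed

lemma D_symmetric_iff_Des_count_symmetric:
  assumes n: "n \<ge> 1"
  shows "D_symmetric n B \<longleftrightarrow> Des_count_symmetric n B"
proof
  assume D: "D_symmetric n B"
  show "Des_count_symmetric n B"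
    unfolding Des_count_symmetric_def
  proof clarify
    fix J K assume J: "J \<subseteq> {1..n - 1}" and K: "K \<subseteq> {1..n - 1}" and sim: "co_sim n J K"
    obtain U where U: "ordered_set_partition n U" "partition_star U = {1..n - 1} - J"
      "{1..n - 1} - delta n U ` ({1..n - 1} - J) = K"
      by (rule co_sim_imp_delta[OF J K sim n])
    have "Des_count n B ({1..n - 1} - ({1..n - 1} - J)) =
        Des_count n B ({1..n - 1} - delta n U ` ({1..n - 1} - J))"
      using D[unfolded D_symmetric_iff] U(1,2) by blast
    then show "Des_count n B J = Des_count n B K" using J U(3) by (simp add: double_diff)
  qed
next
  assume "Des_count_symmetric n B"
  then have sym: "Des_count n B J = Des_count n B K"
    if "J \<subseteq> {1..n - 1}" "K \<subseteq> {1..n - 1}" "co_sim n J K" for J K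
    using that unfolding Des_count_symmetric_def by blast
  show "D_symmetric n B"
    unfolding D_symmetric_iff
    by (intro allI impI sym Diff_subset co_sim_delta[OF _ _ n])
qed


section \<open>The quasisymmetric generating function\<close>

lemma sum_take_le: "sum_list (take k \<alpha>) \<le> sum_list (\<alpha> :: nat list)"
  by (metis append_take_drop_id le_add1 sum_list_append)

lemma partial_sums_bounds:
  assumes "sum_list \<alpha> = n"
  shows "{0, n} \<subseteq> partial_sums \<alpha>" "partial_sums \<alpha> \<subseteq> {..n}"
proof -
  have "sum_list (take 0 \<alpha>) \<in> partial_sums \<alpha>" "sum_list (take (length \<alpha>) \<alpha>) \<in> partial_sums \<alpha>"
    unfolding partial_sums_def by (intro imageI; simp)+
  then show "{0, n} \<subseteq> partial_sums \<alpha>" using assms by simp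
  show "partial_sums \<alpha> \<subseteq> {..n}" using sum_take_le assms by (auto simp: partial_sums_def)
qed

lemma partial_sums_Cons: "partial_sums (a # \<alpha>) = insert 0 ((+) a ` partial_sums \<alpha>)"
proof -
  have "{..Suc m} = insert 0 (Suc ` {..m})" for m by (auto simp: image_iff) (metis Suc_pred atMost_iff gr0I le_Suc_eq Suc_le_mono)
  then show ?thesis by (simp add: partial_sums_def image_image)
qed

lemma partial_sums_append_subset:
  assumes "sum_list \<beta> = a"
  shows "{s. a + s \<in> partial_sums (\<beta> @ \<gamma>)} \<subseteq> partial_sums \<gamma>"
proof clarify
  fix s assume "a + s \<in> partial_sums (\<beta> @ \<gamma>)"
  then obtain k where k: "k \<le> length (\<beta> @ \<gamma>)" "a + s = sum_list (take k (\<beta> @ \<gamma>))"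
    by (auto simp: partial_sums_def)
  show "s \<in> partial_sums \<gamma>"
  proof (cases "length \<beta> \<le> k")
    case True
    then have "s = sum_list (take (k - length \<beta>) \<gamma>)" using k(2) assms by simp
    moreover have "k - length \<beta> \<in> {..length \<gamma>}" using k(1) by auto
    ultimately show ?thesis unfolding partial_sums_def by (rule image_eqI)
  next
    case False
    then have "a + s \<le> a"
      using k(2) assms sum_take_le[of k \<beta>] by simp
    then show ?thesis using partial_sums_bounds(1)[OF refl, of \<gamma>] by simp
  qed
qed

lemma sum_concat: "sum_list (concat bs) = sum_list (map sum_list (bs :: nat list list))"
  by (induction bs) auto

text \<open>
  Grouping the parts of \<open>\<beta>\<close> keeps some of its partial sums.  Conversely a partial sum of \<open>\<alpha>\<close> that is
  also one of \<open>\<beta>\<close> tells where to cut \<open>\<beta>\<close>; the groups are split off one at a time.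
\<close>

lemma refines_iff_partial_sums:
  assumes "0 \<notin> set \<alpha>" "0 \<notin> set \<beta>" "sum_list \<alpha> = sum_list \<beta>"
  shows "refines \<beta> \<alpha> \<longleftrightarrow> partial_sums \<alpha> \<subseteq> partial_sums \<beta>"
proof
  assume "refines \<beta> \<alpha>"
  then obtain bs where bs: "concat bs = \<beta>" "map sum_list bs = \<alpha>" by (auto simp: refines_def)
  show "partial_sums \<alpha> \<subseteq> partial_sums \<beta>"
  proof
    fix s assume "s \<in> partial_sums \<alpha>"
    then obtain k where "s = sum_list (take k \<alpha>)" by (auto simp: partial_sums_def)
    then have "s = sum_list (concat (take k bs))" by (simp add: bs(2)[symmetric] take_map sum_concat)
    moreover define l where "l = length (concat (take k bs))"
    moreover have "\<beta> = concat (take k bs) @ concat (drop k bs)"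
      unfolding bs(1)[symmetric] by (metis append_take_drop_id concat_append)
    ultimately have "s = sum_list (take l \<beta>)" "l \<le> length \<beta>" by simp_all
    then show "s \<in> partial_sums \<beta>" unfolding partial_sums_def by (intro image_eqI) simp_all
  qed
next
  assume "partial_sums \<alpha> \<subseteq> partial_sums \<beta>"
  then show "refines \<beta> \<alpha>" using assms
  proof (induction \<alpha> arbitrary: \<beta>)
    case Nil
    then have "\<beta> = []" by (cases \<beta>) auto
    then show ?case by (auto simp: refines_def intro!: exI[of _ "[]"])
  next
    case (Cons a \<alpha>)
    have a: "a \<noteq> 0" using Cons.prems(2) by auto
    have "a + 0 \<in> partial_sums (a # \<alpha>)"
      unfolding partial_sums_Cons using partial_sums_bounds(1)[OF refl, of \<alpha>] by blast
    then have "a \<in> partial_sums \<beta>" using Cons.prems(1) by auto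
    then obtain k where k: "k \<le> length \<beta>" "a = sum_list (take k \<beta>)"
      by (auto simp: partial_sums_def)
    define \<beta>1 \<beta>2 where "\<beta>1 = take k \<beta>" and "\<beta>2 = drop k \<beta>"
    have \<beta>: "\<beta> = \<beta>1 @ \<beta>2" and \<beta>1: "sum_list \<beta>1 = a" by (simp_all add: \<beta>1_def \<beta>2_def k(2))
    have pos: "0 \<notin> set \<beta>2" using Cons.prems(3) by (simp add: \<beta>)
    have "partial_sums \<alpha> \<subseteq> {s. a + s \<in> partial_sums (\<beta>1 @ \<beta>2)}"
      using Cons.prems(1) by (auto simp: partial_sums_Cons \<beta>)
    also have "\<dots> \<subseteq> partial_sums \<beta>2" using \<beta>1 by (rule partial_sums_append_subset)
    finally have "refines \<beta>2 \<alpha>" using Cons.prems pos \<beta>1 by (intro Cons.IH) (auto simp: \<beta>)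
    then obtain bs where bs: "[] \<notin> set bs" "concat bs = \<beta>2" "map sum_list bs = \<alpha>"
      by (auto simp: refines_def)
    have "\<beta>1 \<noteq> []" using a \<beta>1 by (intro notI) simp
    then have "[] \<notin> set (\<beta>1 # bs)" using bs(1) by simp
    moreover have "concat (\<beta>1 # bs) = \<beta>" using bs(2) by (simp add: \<beta>)
    moreover have "map sum_list (\<beta>1 # bs) = a # \<alpha>" using bs(3) \<beta>1 by simp
    ultimately have "[] \<notin> set (\<beta>1 # bs) \<and> concat (\<beta>1 # bs) = \<beta> \<and> map sum_list (\<beta>1 # bs) = a # \<alpha>"
      by blast
    then show ?case unfolding refines_def by (rule exI)
  qed
qed

text \<open>
  A monomial is the multiset of its variables, each as often as its exponent.  It can be written with
  increasing indices and positive exponents in one way only.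
\<close>

lemma monom_of_eq_iff:
  assumes X: "\<And>x. count X x = Poly_Mapping.lookup m x"
    and "0 \<notin> set \<beta>" "length is = length \<beta>" "sorted_wrt (<) is"
  shows "monom_of is \<beta> = m \<longleftrightarrow> is = keys_list X \<and> \<beta> = content X"
proof
  have dist: "distinct is" using assms(4) by (simp add: strict_sorted_iff)
  have at: "Poly_Mapping.lookup (monom_of is \<beta>) (is ! k) = \<beta> ! k" if "k < length \<beta>" for k
  proof -
    have "Poly_Mapping.lookup (monom_of is \<beta>) (is ! k) = (\<Sum>j<length \<beta>. if j = k then \<beta> ! j else 0)"
      using that assms(3) dist
      by (auto simp: monom_of_def lookup_sum lookup_single when_def nth_eq_iff_index_eq intro!: sum.cong)
    then show ?thesis using that by simp
  qed
  assume eq: "monom_of is \<beta> = m"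
  have "set_mset X = set is"
  proof (intro equalityI subsetI)
    fix x assume "x \<in> set is"
    then obtain k where k: "k < length \<beta>" "x = is ! k" using assms(3) by (auto simp: in_set_conv_nth)
    then have "\<beta> ! k \<noteq> 0" using assms(2) by (metis nth_mem)
    then have "count X x \<noteq> 0" using at[OF k(1)] k(2) eq X by simp
    then show "x \<in># X" by (simp add: count_eq_zero_iff)
  next
    fix x assume "x \<in># X"
    then have "Poly_Mapping.lookup (monom_of is \<beta>) x \<noteq> 0" using eq X by (metis count_eq_zero_iff)
    then obtain k where "k < length \<beta>" "is ! k = x"
      by (auto simp: monom_of_def lookup_sum lookup_single when_def split: if_splits elim!: sum.not_neutral_contains_not_neutral)
    then show "x \<in> set is" using assms(3) by auto
  qed
  then have "keys_list X = is"
    using assms(4) by (simp add: keys_list_def strict_sorted_iff sorted_list_of_set.idem_if_sorted_distinct)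
  moreover have "\<beta> = map (count X) is"
    using assms(3) at eq X by (intro nth_equalityI) auto
  ultimately show "is = keys_list X \<and> \<beta> = content X" by (simp add: content_def)
next
  assume e: "is = keys_list X \<and> \<beta> = content X"
  have "Poly_Mapping.lookup (monom_of is \<beta>) x = Poly_Mapping.lookup m x" for x
  proof -
    have "Poly_Mapping.lookup (monom_of is \<beta>) x =
        (\<Sum>k<length (keys_list X). (count X (keys_list X ! k) when keys_list X ! k = x))"
      using e by (auto simp: monom_of_def lookup_sum lookup_single content_def intro!: sum.cong)
    also have "\<dots> = sum_list (map (\<lambda>y. count X y when y = x) (keys_list X))"
      by (simp add: sum_list_sum_nth atLeast0LessThan)
    also have "\<dots> = (\<Sum>y\<in>set_mset X. count X y when y = x)"
      by (simp add: sum_list_distinct_conv_sum_set distinct_keys_list)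
    also have "\<dots> = count X x"
      by (simp add: when_def sum.delta not_in_iff)
    finally show ?thesis by (simp add: X)
  qed
  then show "monom_of is \<beta> = m" by (intro poly_mapping_eqI)
qed

lemma M_qsym_eq:
  assumes X: "\<And>x. count X x = Poly_Mapping.lookup m x" and "0 \<notin> set \<beta>"
  shows "M_qsym \<beta> m = of_bool (\<beta> = content X)"
proof -
  have "{is. length is = length \<beta> \<and> sorted_wrt (<) is \<and> monom_of is \<beta> = m} =
      (if \<beta> = content X then {keys_list X} else {})"
    (is "?S = ?T")
  proof -
    have "is \<in> ?S \<longleftrightarrow> is = keys_list X \<and> \<beta> = content X" for "is"
      using monom_of_eq_iff[OF X assms(2), of "is"] sorted_keys_list[of X] by (auto simp: content_def)
    then show ?thesis by auto
  qed
  then show ?thesis by (simp add: M_qsym_def)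
qed

text \<open>
  Among the compositions \<open>\<beta>\<close> refining \<open>co n D\<close> only the list of exponents of the monomial contributes,
  and it refines \<open>co n D\<close> exactly if the break set of the monomial contains \<open>D\<close>.
\<close>

lemma F_qsym_co_eq:
  assumes X: "\<And>x. count X x = Poly_Mapping.lookup m x" and D: "D \<subseteq> {1..n - 1}" and n: "n \<ge> 1"
  shows "F_qsym (co n D) m = of_bool (size X = n \<and> D \<subseteq> breaks X)"
proof -
  let ?\<alpha> = "content (block_mset n D)"
  have \<alpha>: "co n D = ?\<alpha>" using D n by (rule co_eq_content)
  have sum: "sum_list ?\<alpha> = n" by (simp add: sum_list_content)
  let ?S = "{\<beta>. is_composition n \<beta> \<and> refines \<beta> ?\<alpha>}"
  have fin: "finite ?S" by (rule finite_subset[OF _ finite_compositions[of n]]) auto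
  have "F_qsym (co n D) m = (\<Sum>\<beta>\<in>?S. of_bool (\<beta> = content X))"
    unfolding F_qsym_def \<alpha> sum
    by (intro sum.cong refl) (auto simp: M_qsym_eq[OF X] is_composition_def)
  also have "\<dots> = of_bool (content X \<in> ?S)"
    using fin by (simp add: of_bool_def sum.delta)
  also have "content X \<in> ?S \<longleftrightarrow> size X = n \<and> D \<subseteq> breaks X"
  proof (cases "size X = n")
    case True
    have "content X \<in> ?S \<longleftrightarrow> partial_sums ?\<alpha> \<subseteq> partial_sums (content X)"
      using True sum refines_iff_partial_sums[OF zero_notin_content zero_notin_content, of "block_mset n D" X]
      by (simp add: is_composition_def sum_list_content zero_notin_content)
    also have "\<dots> \<longleftrightarrow> partial_sums ?\<alpha> \<inter> {1..n - 1} \<subseteq> partial_sums (content X) \<inter> {1..n - 1}"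
    proof -
      have "{..n} = {0, n} \<union> {1..n - 1}" by auto
      then show ?thesis
        using partial_sums_bounds[OF sum] partial_sums_bounds[of "content X" n] True
        by (auto simp: sum_list_content)
    qed
    also have "\<dots> \<longleftrightarrow> D \<subseteq> breaks X"
      using True breaks_eq_partial_sums[of "block_mset n D"] breaks_eq_partial_sums[of X] D
      by (simp add: breaks_block_mset)
    finally show ?thesis using True by simp
  qed (simp add: is_composition_def sum_list_content)
  finally show ?thesis .
qed

lemma Q_qsym_eq:
  assumes X: "\<And>x. count X x = Poly_Mapping.lookup m x" and n: "n \<ge> 1"
  shows "Q_qsym n B m = (if size X = n then int (Des_count n B (breaks X)) else 0)"
proof -
  have "Q_qsym n B m = (\<Sum>\<pi>\<in>#B. of_bool (size X = n \<and> Des n \<pi> \<subseteq> breaks X))"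
    unfolding Q_qsym_def by (simp only: F_qsym_co_eq[OF X Des_subset n])
  also have "\<dots> = (if size X = n then int (Des_count n B (breaks X)) else 0)"
    unfolding Des_count_def by (induction B) auto
  finally show ?thesis .
qed

lemma count_image_mset_inj:
  assumes "inj f"
  shows "count (image_mset f X) (f x) = count X x"
proof (cases "x \<in># X")
  case True
  then show ?thesis using assms by (intro count_image_mset_inj_on) (rule inj_on_subset, auto)
next
  case False
  then have "f x \<notin># image_mset f X" using assms by (auto simp: inj_eq)
  then show ?thesis using False by (simp only: not_in_iff)
qed

text \<open>
  The coefficients are descent statistics at break sets of monomials.  Permuting variables renames
  the elements of the monomial, and every rearrangement of a composition is realized in this way.
\<close>

lemma symmetric_mset_iff:
  assumes n: "n \<ge> 1"
  shows "symmetric_mset n B \<longleftrightarrow> Des_count_symmetric n B"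
proof
  assume sym: "symmetric_mset n B"
  show "Des_count_symmetric n B"
    unfolding Des_count_symmetric_def
  proof clarify
    fix J K assume J: "J \<subseteq> {1..n - 1}" and K: "K \<subseteq> {1..n - 1}" and sim: "co_sim n J K"
    obtain \<phi> where \<phi>: "bij \<phi>" "block_mset n K = image_mset \<phi> (block_mset n J)"
      by (rule co_sim_renaming[OF sim J K n])
    define m where "m = Abs_poly_mapping (count (block_mset n K))"
    have m: "Poly_Mapping.lookup m x = count (block_mset n K) x" for x
    proof -
      have "finite {x. count (block_mset n K) x \<noteq> 0}" by (simp flip: set_mset_def not_in_iff add: count_eq_zero_iff)
      then show ?thesis by (simp add: m_def)
    qed
    have m': "Poly_Mapping.lookup (Poly_Mapping.map_key \<phi> m) x = count (block_mset n J) x" for x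
      using bij_is_inj[OF \<phi>(1)] by (simp add: map_key.rep_eq m \<phi>(2) count_image_mset_inj)
    have "Q_qsym n B (Poly_Mapping.map_key \<phi> m) = Q_qsym n B m"
      using sym \<phi>(1) unfolding symmetric_mset_def symmetric_series_def permute_vars_def by metis
    then show "Des_count n B J = Des_count n B K"
      using J K by (simp add: Q_qsym_eq[OF m[symmetric] n] Q_qsym_eq[OF m'[symmetric] n] breaks_block_mset)
  qed
next
  assume sym: "Des_count_symmetric n B"
  have "Q_qsym n B (Poly_Mapping.map_key \<sigma> m) = Q_qsym n B m" if \<sigma>: "bij \<sigma>" for \<sigma> m
  proof -
    define X where "X = Abs_multiset (Poly_Mapping.lookup (Poly_Mapping.map_key \<sigma> m))"
    have X: "count X x = Poly_Mapping.lookup (Poly_Mapping.map_key \<sigma> m) x" for x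
      unfolding X_def
      by (subst count_Abs_multiset) (use finite_keys[of "Poly_Mapping.map_key \<sigma> m"] in \<open>simp_all add: keys.rep_eq\<close>)
    have inj: "inj \<sigma>" using \<sigma> by (rule bij_is_inj)
    have Y: "count (image_mset \<sigma> X) y = Poly_Mapping.lookup m y" for y
    proof -
      obtain x where "y = \<sigma> x" using bij_is_surj[OF \<sigma>] by (metis surjD)
      then show ?thesis using inj by (simp add: count_image_mset_inj X map_key.rep_eq)
    qed
    show ?thesis
      unfolding Q_qsym_eq[OF X n] Q_qsym_eq[OF Y n]
      using Des_count_breaks_image[OF sym inj_on_subset[OF inj subset_UNIV] _ n, of X] by simp
  qed
  then show "symmetric_mset n B"
    unfolding symmetric_mset_def symmetric_series_def permute_vars_def by blast
qed

theorem theorem3p3: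
  fixes n :: nat and B :: "(nat \<Rightarrow> nat) multiset"
  assumes "n \<ge> 1"
    and "\<And>\<pi>. \<pi> \<in># B \<Longrightarrow> \<pi> permutes {1..n}"
  shows
    "(D_symmetric n B \<longleftrightarrow>
        (\<forall>J. J \<subseteq> {1..n - 1} \<longrightarrow> D_commutative n B (inverse_J_class n J))) \<and>
     (D_symmetric n B \<longleftrightarrow>
        (\<forall>J K. J \<subseteq> {1..n - 1} \<and> K \<subseteq> {1..n - 1} \<and> co_sim n J K \<longrightarrow>
           Des_equiv n (mset_mult B (inverse_J_class n J)) (mset_mult B (inverse_J_class n K)))) \<and>
     (D_symmetric n B \<longleftrightarrow>
        (\<forall>J K. J \<subseteq> {1..n - 1} \<and> K \<subseteq> {1..n - 1} \<and> co_sim n J K \<longrightarrow>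
           Des_equiv n (mset_mult (inverse_J_class n J) B) (mset_mult (inverse_J_class n K) B))) \<and>
     (D_symmetric n B \<longleftrightarrow> symmetric_mset n B)"
proof -
  let ?I = "{1..n - 1}" and ?R = "inverse_J_class n"
  let ?L = "\<lambda>K J. \<Sum>M\<in>pair_msets n K J. Des_count n B (breaks M)"
  have right: "Des_count n (mset_mult B (?R J)) K = ?L J K"
    and left: "Des_count n (mset_mult (?R J) B) K = ?L K J" for J K
    using assms(2) by (simp_all only: Des_count_right_mult Des_count_left_mult sum_factor_count)
  have empty: "?L {} J = Des_count n B J" "?L J {} = Des_count n B J" for J
    using sum_factor_count_empty[of B n J] sum_factor_count[of B n] assms(2) by metis+
  have b: "(\<forall>J. J \<subseteq> ?I \<longrightarrow> D_commutative n B (?R J)) \<longleftrightarrow> Des_count_symmetric n B"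
  proof
    assume "\<forall>J. J \<subseteq> ?I \<longrightarrow> D_commutative n B (?R J)"
    then have "?L K J = ?L J K" if "J \<subseteq> ?I" "K \<subseteq> ?I" for J K
      using that by (simp add: D_commutative_def Des_equiv_iff left right)
    then show "Des_count_symmetric n B" by (rule Des_count_symmetric_if_commutes[OF _ assms(1)])
  next
    assume sym: "Des_count_symmetric n B"
    have "?L J K = ?L K J" for J K
      by (rule sum_pair_msets_symmetric[OF sym assms(1), of prod.swap prod.swap]) (simp_all add: swap_pair_msets)
    then show "\<forall>J. J \<subseteq> ?I \<longrightarrow> D_commutative n B (?R J)"
      unfolding D_commutative_def Des_equiv_iff left right by blast
  qed
  have c: "(\<forall>J K. J \<subseteq> ?I \<and> K \<subseteq> ?I \<and> co_sim n J K \<longrightarrow>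
      Des_equiv n (mset_mult B (?R J)) (mset_mult B (?R K))) \<longleftrightarrow> Des_count_symmetric n B"
  proof
    assume *: "\<forall>J K. J \<subseteq> ?I \<and> K \<subseteq> ?I \<and> co_sim n J K \<longrightarrow>
      Des_equiv n (mset_mult B (?R J)) (mset_mult B (?R K))"
    then have "?L J {} = ?L K {}" if "J \<subseteq> ?I" "K \<subseteq> ?I" "co_sim n J K" for J K
      using that unfolding Des_equiv_iff right by blast
    then show "Des_count_symmetric n B" unfolding empty Des_count_symmetric_def by blast
  next
    assume sym: "Des_count_symmetric n B"
    show "\<forall>J K. J \<subseteq> ?I \<and> K \<subseteq> ?I \<and> co_sim n J K \<longrightarrow>
      Des_equiv n (mset_mult B (?R J)) (mset_mult B (?R K))"
      unfolding Des_equiv_iff right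
      using sum_pair_msets_renaming(2)[OF sym assms(1)] by metis
  qed
  have d: "(\<forall>J K. J \<subseteq> ?I \<and> K \<subseteq> ?I \<and> co_sim n J K \<longrightarrow>
      Des_equiv n (mset_mult (?R J) B) (mset_mult (?R K) B)) \<longleftrightarrow> Des_count_symmetric n B"
  proof
    assume *: "\<forall>J K. J \<subseteq> ?I \<and> K \<subseteq> ?I \<and> co_sim n J K \<longrightarrow>
      Des_equiv n (mset_mult (?R J) B) (mset_mult (?R K) B)"
    then have "?L {} J = ?L {} K" if "J \<subseteq> ?I" "K \<subseteq> ?I" "co_sim n J K" for J K
      using that unfolding Des_equiv_iff left by blast
    then show "Des_count_symmetric n B" unfolding empty Des_count_symmetric_def by blast
  next
    assume sym: "Des_count_symmetric n B"
    show "\<forall>J K. J \<subseteq> ?I \<and> K \<subseteq> ?I \<and> co_sim n J K \<longrightarrow>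
      Des_equiv n (mset_mult (?R J) B) (mset_mult (?R K) B)"
      unfolding Des_equiv_iff left
      using sum_pair_msets_renaming(1)[OF sym assms(1)] by metis
  qed
  show ?thesis
    unfolding b c d D_symmetric_iff_Des_count_symmetric[OF assms(1)] symmetric_mset_iff[OF assms(1)]
    by simp
qed

end
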